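(* Let $G$ be a non-trivial periodic group with set of minimal subgroups $\Omega_G=\{H_i\}_{i\in I}$, such that $H_iH_j=H_jH_i$ for all $H_i,H_j\in\Omega_G$ and $|\Omega_G|\ge 2$. Let $H_r\in\Omega_G$ and let $\{\Gamma_j\}_{j\in J}$ be the set of all connected components of the graph $\Gamma(H_r)$. Then $$|\Sigma(\mathcal K_1(G))|=|\mathcal A_G|=|G|\,|H_r|^{|J|-1}.$$
   Context: For $K\le G$, $g\in G$ write $K^g=g^{-1}Kg$. $\mathcal K_1(G)$ is the set of all right cosets $Ha$ of all non-trivial subgroups $H$ of $G$ with operation $Ha*Kb=\langle H,K^{a^{-1}}\rangle ab$; it is an inverse semigroup whose idempotents are the non-trivial subgroups of $G$, with natural partial order $Ha\le_n Kb\iff Kb\subseteq Ha$, and with Green's relation $Ha\,\mathcal L\,Kb\iff H^a=K^b$. $L_H$ denotes the $\mathcal L$-class of $H$. In an inverse semigroup $S$, elements $x,y$ are compatible, $x\sim y$, if $xy^{-1}$ and $x^{-1}y$ are both idempotents. A subset of $S$ is permissible if its elements are pairwise compatible and it is an order ideal (down-set) for the natural partial order. The completion $C(S)$ is the set of all permissible subsets of $S$ under the usual multiplication of subsets; it is an inverse monoid with identity $E(S)$ (the set of idempotents of $S$). $\Sigma(S)$ denotes the group of units of $C(S)$. Minimal subgroup means minimal non-trivial subgroup; the $H_i$ ($i\in I$) are pairwise distinct. $$\mathcal A_G=\{\{H_ia_i\}_{i\in I}\mid a_i\in G,\ (\forall j,k\in I)\ H_ja_j\sim H_ka_k\text{ and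 }|\{H_ia_i\}_{i\in I}\cap L_{H_j}|=1\}.$$ $\Gamma(H_r)$ is the simple graph with vertex set $V_{H_r}=\Omega_G\setminus\{H_r\}$ and edge set $E_{H_r}=\{(H_i,H_j)\mid H_i\ne H_j,\ H_iH_j\cap H_r=1\}$ (with $H_i,H_j\in V_{H_r}$). *)

theory Defs
  imports "HOL-Algebra.Generated_Groups"
begin

unbundle cardinal_syntax

section \<open>Inverse semigroups and their completions\<close>

text \<open>The record \<open>monoid\<close> requires a unit element, so bare semigroups get their own record.\<close>

record 'a magma = "'a partial_object" +
  smult :: "'a \<Rightarrow> 'a \<Rightarrow> 'a"  (infixl \<open>\<star>\<index>\<close> 70)

definition sg_inverse_of :: "('a, 'b) magma_scheme \<Rightarrow> 'a \<Rightarrow> 'a \<Rightarrow> bool" where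
  "sg_inverse_of S x y \<longleftrightarrow>
     y \<in> carrier S \<and> x \<star>\<^bsub>S\<^esub> y \<star>\<^bsub>S\<^esub> x = x \<and> y \<star>\<^bsub>S\<^esub> x \<star>\<^bsub>S\<^esub> y = y"

definition inverse_semigroup :: "('a, 'b) magma_scheme \<Rightarrow> bool" where
  "inverse_semigroup S \<longleftrightarrow>
     (\<forall>x\<in>carrier S. \<forall>y\<in>carrier S. x \<star>\<^bsub>S\<^esub> y \<in> carrier S) \<and>
     (\<forall>x\<in>carrier S. \<forall>y\<in>carrier S. \<forall>z\<in>carrier S.
        x \<star>\<^bsub>S\<^esub> y \<star>\<^bsub>S\<^esub> z = x \<star>\<^bsub>S\<^esub> (y \<star>\<^bsub>S\<^esub> z)) \<and>
     (\<forall>x\<in>carrier S. \<exists>!y. sg_inverse_of S x y)"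

definition sg_inv :: "('a, 'b) magma_scheme \<Rightarrow> 'a \<Rightarrow> 'a" where
  "sg_inv S x = (THE y. sg_inverse_of S x y)"

definition idempotents :: "('a, 'b) magma_scheme \<Rightarrow> 'a set" where
  "idempotents S = {e \<in> carrier S. e \<star>\<^bsub>S\<^esub> e = e}"

definition natural_le :: "('a, 'b) magma_scheme \<Rightarrow> 'a \<Rightarrow> 'a \<Rightarrow> bool" where
  "natural_le S x y \<longleftrightarrow> (\<exists>e\<in>idempotents S. x = e \<star>\<^bsub>S\<^esub> y)"

definition compatible :: "('a, 'b) magma_scheme \<Rightarrow> 'a \<Rightarrow> 'a \<Rightarrow> bool" where
  "compatible S x y \<longleftrightarrow>
     x \<star>\<^bsub>S\<^esub> sg_inv S y \<in> idempotents S \<and> sg_inv S x \<star>\<^bsub>S\<^esub> y \<in> idempotents S"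

definition permissible :: "('a, 'b) magma_scheme \<Rightarrow> 'a set \<Rightarrow> bool" where
  "permissible S A \<longleftrightarrow> A \<subseteq> carrier S \<and>
     (\<forall>x\<in>A. \<forall>y\<in>A. compatible S x y) \<and>
     (\<forall>y\<in>A. \<forall>x\<in>carrier S. natural_le S x y \<longrightarrow> x \<in> A)"

definition completion :: "('a, 'b) magma_scheme \<Rightarrow> 'a set monoid" where
  "completion S =
     \<lparr>carrier = {A. permissible S A},
      mult = (\<lambda>A B. {x \<star>\<^bsub>S\<^esub> y | x y. x \<in> A \<and> y \<in> B}),
      one = idempotents S\<rparr>"

definition Sigma_group :: "('a, 'b) magma_scheme \<Rightarrow> 'a set monoid" where
  "Sigma_group S = units_of (completion S)"

definition left_ideal1 :: "('a, 'b) magma_scheme \<Rightarrow> 'a \<Rightarrow> 'a set" where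
  "left_ideal1 S x = insert x {s \<star>\<^bsub>S\<^esub> x | s. s \<in> carrier S}"

definition green_L :: "('a, 'b) magma_scheme \<Rightarrow> 'a \<Rightarrow> 'a \<Rightarrow> bool" where
  "green_L S x y \<longleftrightarrow> left_ideal1 S x = left_ideal1 S y"

definition L_class :: "('a, 'b) magma_scheme \<Rightarrow> 'a \<Rightarrow> 'a set" where
  "L_class S x = {y \<in> carrier S. green_L S x y}"


section \<open>The inverse semigroup of cosets of non-trivial subgroups\<close>

definition conj_set :: "('a, 'b) monoid_scheme \<Rightarrow> 'a set \<Rightarrow> 'a \<Rightarrow> 'a set" where
  "conj_set G K g = (\<lambda>k. inv\<^bsub>G\<^esub> g \<otimes>\<^bsub>G\<^esub> k \<otimes>\<^bsub>G\<^esub> g) ` K"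

definition nontriv_subgroup :: "('a, 'b) monoid_scheme \<Rightarrow> 'a set \<Rightarrow> bool" where
  "nontriv_subgroup G H \<longleftrightarrow> subgroup H G \<and> H \<noteq> {\<one>\<^bsub>G\<^esub>}"

text \<open>
  The product of two cosets is written in terms of representatives; the definite description is
  justified by \<open>coset_product_eq\<close> below.
\<close>

definition coset_product :: "('a, 'b) monoid_scheme \<Rightarrow> 'a set \<Rightarrow> 'a set \<Rightarrow> 'a set" where
  "coset_product G X Y = (THE Z. \<exists>H a K b.
     nontriv_subgroup G H \<and> a \<in> carrier G \<and> X = H #>\<^bsub>G\<^esub> a \<and>
     nontriv_subgroup G K \<and> b \<in> carrier G \<and> Y = K #>\<^bsub>G\<^esub> b \<and>
     Z = generate G (H \<union> conj_set G K (inv\<^bsub>G\<^esub> a)) #>\<^bsub>G\<^esub> (a \<otimes>\<^bsub>G\<^esub> b))"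

definition K1 :: "('a, 'b) monoid_scheme \<Rightarrow> 'a set magma" where
  "K1 G =
     \<lparr>carrier = {H #>\<^bsub>G\<^esub> a | H a. nontriv_subgroup G H \<and> a \<in> carrier G},
      smult = coset_product G\<rparr>"


section \<open>Minimal subgroups, the families $\mathcal{A}_G$ and the graphs $\Gamma(H_r)$\<close>

definition periodic_group :: "('a, 'b) monoid_scheme \<Rightarrow> bool" where
  "periodic_group G \<longleftrightarrow> (\<forall>x\<in>carrier G. \<exists>n::nat. n > 0 \<and> x [^]\<^bsub>G\<^esub> n = \<one>\<^bsub>G\<^esub>)"

definition minimal_subgroups :: "('a, 'b) monoid_scheme \<Rightarrow> 'a set set" where
  "minimal_subgroups G =
     {H. nontriv_subgroup G H \<and> (\<forall>K. nontriv_subgroup G K \<and> K \<subseteq> H \<longrightarrow> K = H)}"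

text \<open>
  The set of minimal subgroups serves as its own index set, so that a choice of representatives
  $(a_i)_{i\in I}$ is a function on \<open>minimal_subgroups G\<close>.
\<close>

definition A_families :: "('a, 'b) monoid_scheme \<Rightarrow> 'a set set set" where
  "A_families G =
     {(\<lambda>H. H #>\<^bsub>G\<^esub> a H) ` minimal_subgroups G | a.
        a \<in> minimal_subgroups G \<rightarrow> carrier G \<and>
        (\<forall>H\<in>minimal_subgroups G. \<forall>K\<in>minimal_subgroups G.
           compatible (K1 G) (H #>\<^bsub>G\<^esub> a H) (K #>\<^bsub>G\<^esub> a K) \<and>
           card ((\<lambda>H. H #>\<^bsub>G\<^esub> a H) ` minimal_subgroups G \<inter> L_class (K1 G) H) = 1)}"

definition Gamma_verts :: "('a, 'b) monoid_scheme \<Rightarrow> 'a set \<Rightarrow> 'a set set" where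
  "Gamma_verts G Hr = minimal_subgroups G - {Hr}"

definition Gamma_edges :: "('a, 'b) monoid_scheme \<Rightarrow> 'a set \<Rightarrow> ('a set \<times> 'a set) set" where
  "Gamma_edges G Hr =
     {(H, K). H \<in> Gamma_verts G Hr \<and> K \<in> Gamma_verts G Hr \<and> H \<noteq> K \<and>
              (H <#>\<^bsub>G\<^esub> K) \<inter> Hr = {\<one>\<^bsub>G\<^esub>}}"

text \<open>Connected components, given by their vertex sets.\<close>

definition conn_components :: "'v set \<Rightarrow> ('v \<times> 'v) set \<Rightarrow> 'v set set" where
  "conn_components V E = V // {(u, v). u \<in> V \<and> v \<in> V \<and> (u, v) \<in> E\<^sup>*}"

text \<open>
  The cardinal $|J|-1$: the cardinality of $J$ with one element removed, which does not depend on
  the element. For infinite $J$ it is $|J|$.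
\<close>

definition card_minus_one :: "'v set \<Rightarrow> 'v rel" where
  "card_minus_one J = |J - {SOME j. j \<in> J}|"


section \<open>Consistency of the definitions\<close>

lemma card_minus_one_remove:
  assumes "j \<in> J"
  shows "card_minus_one J =o |J - {j}|"
proof -
  define i where "i = (SOME j. j \<in> J)"
  have i: "i \<in> J" unfolding i_def using assms by (rule someI)
  have "bij_betw (\<lambda>x. if x = j then i else x) (J - {i}) (J - {j})"
    by (rule bij_betw_byWitness[where f' = "\<lambda>x. if x = i then j else x"])
       (use i assms in auto)
  then show ?thesis
    unfolding card_minus_one_def i_def[symmetric] using card_of_ordIso by blast
qed

lemma card_minus_one_csum:
  assumes "J \<noteq> {}"
  shows "card_minus_one J +c cone =o |J|"
proof -
  define i where "i = (SOME j. j \<in> J)"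
  have i: "i \<in> J" unfolding i_def using assms by (simp add: some_in_eq)
  have "bij_betw (case_sum id (\<lambda>_. i)) ((J - {i}) <+> {()}) J"
    by (rule bij_betw_byWitness[where f' = "\<lambda>x. if x = i then Inr () else Inl x"])
       (use i in auto)
  then show ?thesis
    unfolding card_minus_one_def i_def[symmetric] csum_def cone_def Field_card_of
    by (rule card_of_ordIsoI)
qed

context group
begin

lemma cancel_inv [simp]:
  assumes "g \<in> carrier G" "x \<in> carrier G"
  shows "g \<otimes> (inv g \<otimes> x) = x" "inv g \<otimes> (g \<otimes> x) = x"
  using assms by (simp_all add: m_assoc[symmetric])

lemma generate_id: "subgroup H G \<Longrightarrow> generate G H = H"
  by (metis generateI subset_refl)

lemma conj_set_closed: "K \<subseteq> carrier G \<Longrightarrow> g \<in> carrier G \<Longrightarrow> conj_set G K g \<subseteq> carrier G"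
  by (auto simp: conj_set_def)

lemma conj_set_mult:
  assumes "K \<subseteq> carrier G" "g \<in> carrier G" "h \<in> carrier G"
  shows "conj_set G (conj_set G K g) h = conj_set G K (g \<otimes> h)"
proof -
  have "inv h \<otimes> (inv g \<otimes> k \<otimes> g) \<otimes> h = inv (g \<otimes> h) \<otimes> k \<otimes> (g \<otimes> h)" if "k \<in> K" for k
    using that assms by (auto simp: inv_mult_group m_assoc subset_iff)
  then show ?thesis
    by (auto simp: conj_set_def image_image)
qed

lemma conj_set_one: "K \<subseteq> carrier G \<Longrightarrow> conj_set G K \<one> = K"
  by (force simp: conj_set_def subset_iff image_iff)

lemma conj_set_Un: "conj_set G (A \<union> B) g = conj_set G A g \<union> conj_set G B g"
  by (auto simp: conj_set_def)

lemma conj_generate: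
  assumes "K \<subseteq> carrier G" "g \<in> carrier G"
  shows "conj_set G (generate G K) g = generate G (conj_set G K g)"
proof -
  interpret c: group_hom G G "\<lambda>k. inv g \<otimes> k \<otimes> g"
    using assms by unfold_locales
      (auto simp: hom_def m_assoc)
  show ?thesis unfolding conj_set_def using c.generate_img assms by simp
qed

lemma conj_subgroup:
  assumes "subgroup K G" "g \<in> carrier G"
  shows "subgroup (conj_set G K g) G"
proof -
  have K: "K \<subseteq> carrier G" using assms(1) by (rule subgroup.subset)
  have "conj_set G K g = generate G (conj_set G K g)"
    using conj_generate[OF K assms(2)] assms(1) by (simp add: generate_id)
  then show ?thesis
    using generate_is_subgroup[OF conj_set_closed[OF K assms(2)]] by simp
qed

lemma generate_eqI:
  assumes "A \<subseteq> carrier G" "B \<subseteq> carrier G" "A \<subseteq> generate G B" "B \<subseteq> generate G A"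
  shows "generate G A = generate G B"
  using assms generate_is_subgroup generate_subgroup_incl by (metis subset_antisym)

lemma generate_Un_generate:
  assumes "A \<subseteq> carrier G" "B \<subseteq> carrier G"
  shows "generate G (generate G A \<union> B) = generate G (A \<union> B)"
proof (rule generate_eqI)
  show "generate G A \<union> B \<subseteq> generate G (A \<union> B)"
    using mono_generate[of A "A \<union> B"] by (auto intro: generate.incl)
  show "A \<union> B \<subseteq> generate G (generate G A \<union> B)"
    by (auto intro: generate.incl)
qed (use assms generate_incl in auto)

lemma generate_conj_mem:
  assumes "subgroup H G" "h \<in> H" "M \<subseteq> carrier G"
  shows "generate G (H \<union> conj_set G M h) = generate G (H \<union> M)"
proof -
  have H: "H \<subseteq> carrier G" using assms(1) by (rule subgroup.subset)
  have sub: "conj_set G N g \<subseteq> generate G (H \<union> N)" if "g \<in> H" for N g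
    unfolding conj_set_def using that subgroup.m_inv_closed[OF assms(1)]
    by (auto intro!: generate.eng intro: generate.incl)
  have h: "h \<in> carrier G" "inv h \<in> H" using assms H by (auto intro: subgroup.m_inv_closed)
  have "conj_set G (conj_set G M h) (inv h) = M"
    using assms h by (simp add: conj_set_mult conj_set_one)
  then show ?thesis
    using sub[OF assms(2), of M] sub[OF h(2), of "conj_set G M h"] H assms h
    by (intro generate_eqI) (auto intro: generate.incl dest: conj_set_closed)
qed

lemma coset_eq_iff:
  assumes "subgroup H G" "subgroup H' G" "a \<in> carrier G" "a' \<in> carrier G"
  shows "H #> a = H' #> a' \<longleftrightarrow> H = H' \<and> a' \<otimes> inv a \<in> H"
proof
  assume eq: "H #> a = H' #> a'"
  have Hs: "H \<subseteq> carrier G" "H' \<subseteq> carrier G" using assms by (auto dest: subgroup.subset)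
  have "a' \<in> H #> a" using eq rcos_self[OF assms(4) assms(2)] by simp
  then obtain h where h: "h \<in> H" "a' = h \<otimes> a" by (auto simp: r_coset_def)
  have "H #> a' = H #> a"
    using repr_independence[OF \<open>a' \<in> H #> a\<close> assms(3,1)] by simp
  then have "H #> a' = H' #> a'" using eq by simp
  then have "(H #> a') #> inv a' = (H' #> a') #> inv a'" by simp
  then have "H = H'" using Hs assms by (simp add: coset_mult_assoc)
  moreover have "a' \<otimes> inv a \<in> H" using h Hs assms by (auto simp: m_assoc subset_iff)
  ultimately show "H = H' \<and> a' \<otimes> inv a \<in> H" by simp
next
  assume *: "H = H' \<and> a' \<otimes> inv a \<in> H"
  then have "a' = (a' \<otimes> inv a) \<otimes> a" using assms by (simp add: m_assoc)
  then have "a' \<in> H #> a" using * by (auto simp: r_coset_def)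
  then show "H #> a = H' #> a'" using * repr_independence assms by blast
qed

lemma coset_product_wd:
  assumes H: "subgroup H G" "h \<in> H" and K: "subgroup K G" "k \<in> K"
    and a: "a \<in> carrier G" and b: "b \<in> carrier G"
  shows "generate G (H \<union> conj_set G K (inv (h \<otimes> a))) #> ((h \<otimes> a) \<otimes> (k \<otimes> b)) =
         generate G (H \<union> conj_set G K (inv a)) #> (a \<otimes> b)"
proof -
  have Hs: "H \<subseteq> carrier G" "K \<subseteq> carrier G" using H K by (auto dest: subgroup.subset)
  then have hk: "h \<in> carrier G" "k \<in> carrier G" "inv h \<in> H"
    using H K by (auto intro: subgroup.m_inv_closed)
  let ?J = "H \<union> conj_set G K (inv a)"
  have J: "?J \<subseteq> carrier G" using conj_set_closed[OF Hs(2), of "inv a"] Hs a by simp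
  have "conj_set G K (inv (h \<otimes> a)) = conj_set G (conj_set G K (inv a)) (inv h)"
    using Hs a hk by (simp add: conj_set_mult inv_mult_group)
  then have 1: "generate G (H \<union> conj_set G K (inv (h \<otimes> a))) = generate G ?J"
    using generate_conj_mem[OF H(1) hk(3), of "conj_set G K (inv a)"] conj_set_closed Hs a by simp
  have "a \<otimes> k \<otimes> inv a \<in> conj_set G K (inv a)"
    using K a by (auto simp: conj_set_def)
  then have "h \<otimes> (a \<otimes> k \<otimes> inv a) \<in> generate G ?J"
    using H by (auto intro!: generate.eng[of h] intro: generate.incl)
  moreover have "(h \<otimes> a) \<otimes> (k \<otimes> b) \<otimes> inv (a \<otimes> b) = h \<otimes> (a \<otimes> k \<otimes> inv a)"
  proof -
    have "(h \<otimes> a) \<otimes> (k \<otimes> b) \<otimes> inv (a \<otimes> b) = h \<otimes> (a \<otimes> (k \<otimes> (b \<otimes> inv b) \<otimes> inv a))"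
      using hk a b by (simp add: m_assoc inv_mult_group del: r_inv)
    then show ?thesis using hk a b by (simp add: m_assoc)
  qed
  ultimately show ?thesis unfolding 1
    using coset_eq_iff[of "generate G ?J" "generate G ?J" "a \<otimes> b" "(h \<otimes> a) \<otimes> (k \<otimes> b)"]
      generate_is_subgroup[OF J] a b hk by simp
qed

lemma nontriv_subgroupD: "nontriv_subgroup G H \<Longrightarrow> subgroup H G"
  by (simp add: nontriv_subgroup_def)

lemma coset_product_eq:
  assumes "nontriv_subgroup G H" "nontriv_subgroup G K" "a \<in> carrier G" "b \<in> carrier G"
  shows "coset_product G (H #> a) (K #> b) =
         generate G (H \<union> conj_set G K (inv a)) #> (a \<otimes> b)"
  unfolding coset_product_def
proof (rule the_equality, goal_cases)
  case 1
  then show ?case using assms by blast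
next
  case (2 Z)
  then obtain H' a' K' b' where *: "nontriv_subgroup G H'" "a' \<in> carrier G" "H #> a = H' #> a'"
    "nontriv_subgroup G K'" "b' \<in> carrier G" "K #> b = K' #> b'"
    "Z = generate G (H' \<union> conj_set G K' (inv a')) #> (a' \<otimes> b')" by blast
  have "H = H'" "a' \<otimes> inv a \<in> H" "K = K'" "b' \<otimes> inv b \<in> K"
    using coset_eq_iff * assms nontriv_subgroupD by metis+
  moreover have "a' = (a' \<otimes> inv a) \<otimes> a" "b' = (b' \<otimes> inv b) \<otimes> b"
    using * assms by (simp_all add: m_assoc)
  ultimately show ?case
    using coset_product_wd[of H "a' \<otimes> inv a" K "b' \<otimes> inv b" a b] * assms nontriv_subgroupD
    by metis
qed

lemma nontriv_product:
  assumes "nontriv_subgroup G H" "K \<subseteq> carrier G"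
  shows "nontriv_subgroup G (generate G (H \<union> K))"
proof -
  have "subgroup (generate G (H \<union> K)) G"
    using assms by (auto intro!: generate_is_subgroup dest: nontriv_subgroupD subgroup.subset)
  moreover have "H \<subseteq> generate G (H \<union> K)" by (auto intro: generate.incl)
  moreover obtain x where "x \<in> H" "x \<noteq> \<one>"
    using assms(1) unfolding nontriv_subgroup_def by (metis is_singletonI' is_singleton_def
      subgroup.one_closed singletonD emptyE)
  ultimately show ?thesis unfolding nontriv_subgroup_def by blast
qed

lemma nontriv_conj:
  assumes "nontriv_subgroup G K" "g \<in> carrier G"
  shows "nontriv_subgroup G (conj_set G K g)"
proof -
  have K: "subgroup K G" "K \<noteq> {\<one>}" using assms by (auto simp: nontriv_subgroup_def)
  then have Ks: "K \<subseteq> carrier G" by (auto dest: subgroup.subset)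
  have "conj_set G (conj_set G K g) (inv g) = K"
    using Ks assms by (simp add: conj_set_mult conj_set_one)
  moreover have "conj_set G {\<one>} (inv g) = {\<one>}" using assms by (simp add: conj_set_def)
  ultimately have "conj_set G K g \<noteq> {\<one>}" using K by metis
  then show ?thesis using K assms by (simp add: nontriv_subgroup_def conj_subgroup)
qed

lemma K1_cases:
  assumes "X \<in> carrier (K1 G)"
  obtains H a where "nontriv_subgroup G H" "a \<in> carrier G" "X = H #> a"
  using assms by (auto simp: K1_def)

lemma K1_mem: "nontriv_subgroup G H \<Longrightarrow> a \<in> carrier G \<Longrightarrow> H #> a \<in> carrier (K1 G)"
  by (auto simp: K1_def)

lemma K1_mult:
  assumes "nontriv_subgroup G H" "nontriv_subgroup G K" "a \<in> carrier G" "b \<in> carrier G"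
  shows "(H #> a) \<star>\<^bsub>K1 G\<^esub> (K #> b) = generate G (H \<union> conj_set G K (inv a)) #> (a \<otimes> b)"
  using coset_product_eq[OF assms] by (simp add: K1_def)

lemma K1_mult_subgroup:
  assumes "nontriv_subgroup G H" "nontriv_subgroup G K" "b \<in> carrier G"
  shows "H \<star>\<^bsub>K1 G\<^esub> (K #> b) = generate G (H \<union> K) #> b"
proof -
  have s: "H \<subseteq> carrier G" "K \<subseteq> carrier G"
    using assms by (meson nontriv_subgroupD subgroup.subset)+
  show ?thesis
    using K1_mult[OF assms(1,2) one_closed assms(3)] s assms by (simp add: conj_set_one)
qed

lemma K1_mult_nontriv:
  assumes "nontriv_subgroup G H" "nontriv_subgroup G K" "a \<in> carrier G"
  shows "nontriv_subgroup G (generate G (H \<union> conj_set G K (inv a)))"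
  using assms by (intro nontriv_product)
    (auto dest!: nontriv_subgroupD subgroup.subset dest: conj_set_closed[THEN subsetD, rotated 2])

lemma K1_closed:
  assumes "X \<in> carrier (K1 G)" "Y \<in> carrier (K1 G)"
  shows "X \<star>\<^bsub>K1 G\<^esub> Y \<in> carrier (K1 G)"
  using assms by (elim K1_cases) (simp add: K1_mult K1_mem K1_mult_nontriv)

lemma K1_assoc:
  assumes "X \<in> carrier (K1 G)" "Y \<in> carrier (K1 G)" "Z \<in> carrier (K1 G)"
  shows "X \<star>\<^bsub>K1 G\<^esub> Y \<star>\<^bsub>K1 G\<^esub> Z = X \<star>\<^bsub>K1 G\<^esub> (Y \<star>\<^bsub>K1 G\<^esub> Z)"
proof -
  obtain H a where X: "nontriv_subgroup G H" "a \<in> carrier G" "X = H #> a" using assms K1_cases by metis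
  obtain K b where Y: "nontriv_subgroup G K" "b \<in> carrier G" "Y = K #> b" using assms K1_cases by metis
  obtain L c where Z: "nontriv_subgroup G L" "c \<in> carrier G" "Z = L #> c" using assms K1_cases by metis
  have s: "H \<subseteq> carrier G" "K \<subseteq> carrier G" "L \<subseteq> carrier G"
    using X Y Z by (auto dest!: nontriv_subgroupD subgroup.subset)
  have c: "conj_set G M (inv g) \<subseteq> carrier G" if "M \<subseteq> carrier G" "g \<in> carrier G" for M g
    using that by (simp add: conj_set_closed)
  let ?A = "conj_set G K (inv a)" and ?B = "conj_set G (conj_set G L (inv b)) (inv a)"
  have B: "conj_set G L (inv (a \<otimes> b)) = ?B"
    using s X Y by (simp add: conj_set_mult inv_mult_group)
  have cAB: "?A \<subseteq> carrier G" "?B \<subseteq> carrier G" using s c X Y by simp_all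
  have "generate G (generate G (H \<union> ?A) \<union> ?B) = generate G (H \<union> ?A \<union> ?B)"
    using s cAB by (intro generate_Un_generate) auto
  also have "H \<union> ?A \<union> ?B = ?A \<union> ?B \<union> H" by auto
  also have "generate G (?A \<union> ?B \<union> H) = generate G (generate G (?A \<union> ?B) \<union> H)"
    using s cAB by (intro generate_Un_generate[symmetric]) auto
  also have "\<dots> = generate G (H \<union> generate G (?A \<union> ?B))" by (simp only: Un_commute)
  also have "generate G (?A \<union> ?B) = conj_set G (generate G (K \<union> conj_set G L (inv b))) (inv a)"
    using s c X Y by (simp add: conj_generate conj_set_Un)
  finally show ?thesis
    using X Y Z by (simp add: K1_mult K1_mult_nontriv m_assoc B)
qed

lemma K1_idempotents: "idempotents (K1 G) = {H. nontriv_subgroup G H}"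
proof (intro Set.set_eqI iffI)
  fix X assume "X \<in> idempotents (K1 G)"
  then have X: "X \<in> carrier (K1 G)" "X \<star>\<^bsub>K1 G\<^esub> X = X" by (auto simp: idempotents_def)
  then obtain H a where H: "nontriv_subgroup G H" "a \<in> carrier G" "X = H #> a"
    using K1_cases by metis
  let ?M = "generate G (H \<union> conj_set G H (inv a))"
  have "?M #> (a \<otimes> a) = H #> a" using X H by (simp add: K1_mult)
  then have "?M = H" "a \<otimes> inv (a \<otimes> a) \<in> ?M"
    using coset_eq_iff[of ?M H "a \<otimes> a" a] H K1_mult_nontriv nontriv_subgroupD by auto
  then have "inv a \<in> H" using H by (simp add: inv_mult_group m_assoc[symmetric])
  then have "a \<in> H" using H nontriv_subgroupD subgroup.m_inv_closed by fastforce
  then have "X = H" using H coset_join2 nontriv_subgroupD by blast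
  then show "X \<in> {H. nontriv_subgroup G H}" using H by simp
next
  fix H assume "H \<in> {H. nontriv_subgroup G H}"
  then have H: "nontriv_subgroup G H" by simp
  then have HG: "H \<subseteq> carrier G" by (meson nontriv_subgroupD subgroup.subset)
  then have e: "H #> \<one> = H" by simp
  have "H \<star>\<^bsub>K1 G\<^esub> H = H"
    using K1_mult[OF H H one_closed one_closed] H HG e
    by (simp add: conj_set_one generate_id nontriv_subgroupD)
  then show "H \<in> idempotents (K1 G)" using K1_mem[OF H one_closed] e by (simp add: idempotents_def)
qed

lemma K1_inverse:
  assumes "nontriv_subgroup G H" "a \<in> carrier G"
  shows "sg_inverse_of (K1 G) (H #> a) (conj_set G H a #> inv a)"
proof -
  have H: "subgroup H G" "H \<subseteq> carrier G" using assms
    by (auto dest: nontriv_subgroupD subgroup.subset)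
  have C: "nontriv_subgroup G (conj_set G H a)" using assms nontriv_conj by simp
  show ?thesis
    unfolding sg_inverse_of_def using assms H C
    by (simp add: K1_mem K1_mult K1_mult_subgroup conj_set_mult conj_set_one generate_id conj_subgroup)
qed

lemma K1_idem_commute:
  assumes "e \<in> idempotents (K1 G)" "f \<in> idempotents (K1 G)"
  shows "e \<star>\<^bsub>K1 G\<^esub> f = f \<star>\<^bsub>K1 G\<^esub> e"
proof -
  have ef: "nontriv_subgroup G e" "nontriv_subgroup G f" using assms K1_idempotents by auto
  then have s: "e \<subseteq> carrier G" "f \<subseteq> carrier G" by (auto dest!: nontriv_subgroupD subgroup.subset)
  show ?thesis
    using K1_mult[OF ef one_closed one_closed] K1_mult[OF ef(2,1) one_closed one_closed] s
    by (simp add: conj_set_one Un_commute)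
qed

lemma K1_inverse_unique:
  assumes x: "x \<in> carrier (K1 G)" and y: "sg_inverse_of (K1 G) x y" and z: "sg_inverse_of (K1 G) x z"
  shows "y = z"
proof -
  let ?m = "smult (K1 G)"
  note A = K1_assoc and C = K1_closed
  have yz: "y \<in> carrier (K1 G)" "z \<in> carrier (K1 G)"
    using y z by (auto simp: sg_inverse_of_def)
  have e1: "?m (?m x y) x = x" "?m (?m y x) y = y" "?m (?m x z) x = x" "?m (?m z x) z = z"
    using y z by (auto simp: sg_inverse_of_def)
  have i: "?m x y \<in> idempotents (K1 G)" "?m x z \<in> idempotents (K1 G)"
    "?m y x \<in> idempotents (K1 G)" "?m z x \<in> idempotents (K1 G)"
    using x yz e1 by (auto simp: idempotents_def C) (metis A C)+
  have "y = ?m y (?m x y)" using e1 A x yz by metis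
  also have "\<dots> = ?m y (?m (?m x z) (?m x y))" using e1 A C x yz by metis
  also have "\<dots> = ?m y (?m (?m x y) (?m x z))" using K1_idem_commute i by metis
  also have "\<dots> = ?m (?m y x) z" using e1 A C x yz by metis
  also have "\<dots> = ?m (?m y x) (?m (?m z x) z)" using e1 by simp
  also have "\<dots> = ?m (?m (?m y x) (?m z x)) z" using A C x yz by metis
  also have "\<dots> = ?m (?m (?m z x) (?m y x)) z" using K1_idem_commute i by metis
  also have "\<dots> = ?m (?m z x) z" using e1 A C x yz by metis
  finally show ?thesis using e1 by simp
qed

theorem K1_inverse_semigroup: "inverse_semigroup (K1 G)"
  unfolding inverse_semigroup_def
  using K1_closed K1_assoc K1_inverse K1_inverse_unique by (metis K1_cases)

lemma K1_inv:
  assumes "nontriv_subgroup G H" "a \<in> carrier G"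
  shows "sg_inv (K1 G) (H #> a) = conj_set G H a #> inv a"
  unfolding sg_inv_def
  using K1_inverse[OF assms] K1_inverse_unique K1_mem[OF assms] by (metis the_equality)

lemma K1_natural_le:
  assumes "X \<in> carrier (K1 G)" "Y \<in> carrier (K1 G)"
  shows "natural_le (K1 G) X Y \<longleftrightarrow> Y \<subseteq> X"
proof -
  obtain K b where Y: "nontriv_subgroup G K" "b \<in> carrier G" "Y = K #> b"
    using assms K1_cases by metis
  have K: "subgroup K G" "K \<subseteq> carrier G" using Y by (auto dest: nontriv_subgroupD subgroup.subset)
  have m: "M \<star>\<^bsub>K1 G\<^esub> Y = generate G (M \<union> K) #> b" if M: "nontriv_subgroup G M" for M
    using K1_mult[OF M Y(1) one_closed Y(2)] M Y K
    by (simp add: conj_set_one subgroup.subset[OF nontriv_subgroupD])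
  show ?thesis
  proof
    assume "natural_le (K1 G) X Y"
    then obtain M where "nontriv_subgroup G M" "X = generate G (M \<union> K) #> b"
      using m by (auto simp: natural_le_def K1_idempotents)
    then show "Y \<subseteq> X" using Y by (auto simp: r_coset_def intro: generate.incl)
  next
    assume sub: "Y \<subseteq> X"
    obtain H a where X: "nontriv_subgroup G H" "a \<in> carrier G" "X = H #> a"
      using assms K1_cases by metis
    have H: "subgroup H G" "H \<subseteq> carrier G" using X by (auto dest: nontriv_subgroupD subgroup.subset)
    have "b \<in> X" using sub Y rcos_self K by blast
    then have Xb: "X = H #> b" using X H repr_independence by metis
    have "K \<subseteq> H"
    proof
      fix k assume k: "k \<in> K"
      then have "k \<otimes> b \<in> H #> b" using sub Y Xb by (auto simp: r_coset_def)
      then obtain h where "h \<in> H" "k \<otimes> b = h \<otimes> b" by (auto simp: r_coset_def)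
      then show "k \<in> H" using k K H Y by (metis right_cancel subsetD)
    qed
    then have "generate G (H \<union> K) = H" using H by (simp add: Un_absorb2 generate_id)
    then show "natural_le (K1 G) X Y"
      using m[OF X(1)] X Xb by (auto simp: natural_le_def K1_idempotents intro!: bexI[of _ H])
  qed
qed

lemma conj_set_self:
  assumes "subgroup H G" "h \<in> H"
  shows "conj_set G H h = H"
proof -
  have H: "H \<subseteq> carrier G" using assms(1) by (rule subgroup.subset)
  have sub: "conj_set G H g \<subseteq> H" if "g \<in> H" for g
    unfolding conj_set_def using that assms(1)
    by (auto intro!: subgroup.m_closed subgroup.m_inv_closed)
  have h: "h \<in> carrier G" "inv h \<in> H" using assms H by (auto intro: subgroup.m_inv_closed)
  have "conj_set G (conj_set G H (inv h)) h = H"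
    using h H by (simp add: conj_set_mult conj_set_one)
  moreover have "conj_set G (conj_set G H (inv h)) h \<subseteq> conj_set G H h"
    using sub[OF h(2)] unfolding conj_set_def by blast
  ultimately show ?thesis using sub[OF assms(2)] by blast
qed

lemma K1_green_L:
  assumes H: "nontriv_subgroup G H" "a \<in> carrier G" and K: "nontriv_subgroup G K" "b \<in> carrier G"
  shows "green_L (K1 G) (H #> a) (K #> b) \<longleftrightarrow> conj_set G H a = conj_set G K b"
proof -
  have s: "subgroup H G" "H \<subseteq> carrier G" "subgroup K G" "K \<subseteq> carrier G"
    using H K by (auto dest: nontriv_subgroupD subgroup.subset)
  have sub: "conj_set G K b \<subseteq> conj_set G H a"
    if H: "nontriv_subgroup G H" "a \<in> carrier G" and K: "nontriv_subgroup G K" "b \<in> carrier G"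
      and *: "H #> a \<in> left_ideal1 (K1 G) (K #> b)" for H K a b
  proof -
    have s: "subgroup H G" "H \<subseteq> carrier G" "subgroup K G" "K \<subseteq> carrier G"
      using H K by (auto dest: nontriv_subgroupD subgroup.subset)
    have "\<exists>s\<in>carrier (K1 G). H #> a = s \<star>\<^bsub>K1 G\<^esub> (K #> b)"
    proof (cases "H #> a = K #> b")
      case True
      have "K \<star>\<^bsub>K1 G\<^esub> (K #> b) = K #> b"
        using K1_mult[OF K(1) K(1) one_closed K(2)] s K by (simp add: conj_set_one generate_id)
      moreover have "K \<in> carrier (K1 G)" using K1_mem[OF K(1) one_closed] s by simp
      ultimately show ?thesis using True by metis
    next
      case False
      then show ?thesis using * by (auto simp: left_ideal1_def)
    qed
    then obtain L c where L: "nontriv_subgroup G L" "c \<in> carrier G"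
      "H #> a = (L #> c) \<star>\<^bsub>K1 G\<^esub> (K #> b)" using K1_cases by metis
    let ?M = "generate G (L \<union> conj_set G K (inv c))"
    have "H #> a = ?M #> (c \<otimes> b)" using L K by (simp add: K1_mult)
    then have HM: "H = ?M" and m: "(c \<otimes> b) \<otimes> inv a \<in> H"
      using coset_eq_iff[of H ?M a "c \<otimes> b"] s H K L K1_mult_nontriv nontriv_subgroupD by auto
    have "conj_set G K (inv c) \<subseteq> H" unfolding HM by (auto intro: generate.incl)
    then have "conj_set G (conj_set G K (inv c)) (c \<otimes> b) \<subseteq> conj_set G H (c \<otimes> b)"
      unfolding conj_set_def by blast
    moreover have "conj_set G (conj_set G K (inv c)) (c \<otimes> b) = conj_set G K b"
      using s L K by (simp add: conj_set_mult m_assoc[symmetric])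
    moreover have "conj_set G H (c \<otimes> b) = conj_set G H a"
    proof -
      let ?h = "(c \<otimes> b) \<otimes> inv a"
      have hh: "?h \<in> carrier G" using m s by auto
      have "conj_set G H ?h = H" using s(1) m by (rule conj_set_self)
      moreover have "c \<otimes> b = ?h \<otimes> a" using H K L by (simp add: m_assoc)
      ultimately show ?thesis using s hh H conj_set_mult by metis
    qed
    ultimately show ?thesis by simp
  qed
  have mem: "X \<in> left_ideal1 (K1 G) X" for X by (simp add: left_ideal1_def)
  have ideal: "left_ideal1 (K1 G) (H #> a) \<subseteq> left_ideal1 (K1 G) (K #> b)"
    if H: "nontriv_subgroup G H" "a \<in> carrier G" and K: "nontriv_subgroup G K" "b \<in> carrier G"
      and eq: "conj_set G H a = conj_set G K b" for H K a b
  proof -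
    have s: "subgroup H G" "H \<subseteq> carrier G" "subgroup K G" "K \<subseteq> carrier G"
      using H K by (auto dest: nontriv_subgroupD subgroup.subset)
    have "conj_set G K (inv (a \<otimes> inv b)) = conj_set G (conj_set G K b) (inv a)"
      using s H K by (simp add: conj_set_mult inv_mult_group)
    also have "\<dots> = H" using s H by (simp add: eq[symmetric] conj_set_mult conj_set_one)
    finally have *: "H #> a = (H #> (a \<otimes> inv b)) \<star>\<^bsub>K1 G\<^esub> (K #> b)"
      using s H K by (simp add: K1_mult generate_id m_assoc)
    have t: "H #> (a \<otimes> inv b) \<in> carrier (K1 G)" using H K by (simp add: K1_mem)
    have "s \<star>\<^bsub>K1 G\<^esub> (H #> a) = (s \<star>\<^bsub>K1 G\<^esub> (H #> (a \<otimes> inv b))) \<star>\<^bsub>K1 G\<^esub> (K #> b)"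
      if "s \<in> carrier (K1 G)" for s
      using that t K * by (simp add: K1_assoc K1_mem)
    then show ?thesis using * t K1_closed unfolding left_ideal1_def by blast
  qed
  show ?thesis
  proof
    assume "green_L (K1 G) (H #> a) (K #> b)"
    then have e: "left_ideal1 (K1 G) (H #> a) = left_ideal1 (K1 G) (K #> b)"
      by (simp only: green_L_def)
    have "H #> a \<in> left_ideal1 (K1 G) (K #> b)" "K #> b \<in> left_ideal1 (K1 G) (H #> a)"
      using mem[of "H #> a"] mem[of "K #> b"] unfolding e by simp_all
    then show "conj_set G H a = conj_set G K b"
      using sub[OF H K] sub[OF K H] by (intro subset_antisym) simp_all
  next
    assume e: "conj_set G H a = conj_set G K b"
    show "green_L (K1 G) (H #> a) (K #> b)"
      unfolding green_L_def
      using ideal[OF H K e] ideal[OF K H e[symmetric]] by (rule subset_antisym)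
  qed
qed

end

lemma Gamma_edges_sym:
  assumes "group G" "subgroup Hr G"
  shows "sym (Gamma_edges G Hr)"
proof (rule symI)
  interpret group G by fact
  fix H K assume "(H, K) \<in> Gamma_edges G Hr"
  then have V: "H \<in> Gamma_verts G Hr" "K \<in> Gamma_verts G Hr" "H \<noteq> K"
    and I: "(H <#>\<^bsub>G\<^esub> K) \<inter> Hr = {\<one>\<^bsub>G\<^esub>}" by (auto simp: Gamma_edges_def)
  then have S: "subgroup H G" "subgroup K G"
    by (auto simp: Gamma_verts_def minimal_subgroups_def nontriv_subgroup_def)
  have "x = \<one>\<^bsub>G\<^esub>" if x: "x \<in> K <#>\<^bsub>G\<^esub> H" "x \<in> Hr" for x
  proof -
    obtain k h where kh: "k \<in> K" "h \<in> H" "x = k \<otimes>\<^bsub>G\<^esub> h"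
      using x by (auto simp: set_mult_def)
    then have c: "k \<in> carrier G" "h \<in> carrier G" using S by (meson subgroup.mem_carrier)+
    then have "inv\<^bsub>G\<^esub> x = inv\<^bsub>G\<^esub> h \<otimes>\<^bsub>G\<^esub> inv\<^bsub>G\<^esub> k" using kh by (simp add: inv_mult_group)
    moreover have "inv\<^bsub>G\<^esub> h \<in> H" "inv\<^bsub>G\<^esub> k \<in> K" using kh S by (auto intro: subgroup.m_inv_closed)
    ultimately have "inv\<^bsub>G\<^esub> x \<in> H <#>\<^bsub>G\<^esub> K" by (auto simp: set_mult_def)
    then have "inv\<^bsub>G\<^esub> x = \<one>\<^bsub>G\<^esub>" using I x assms(2) subgroup.m_inv_closed by fastforce
    then show ?thesis using c kh by (metis inv_inv inv_one m_closed)
  qed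
  moreover have "\<one>\<^bsub>G\<^esub> \<in> K <#>\<^bsub>G\<^esub> H"
    using S by (force simp: set_mult_def dest: subgroup.one_closed)
  ultimately have "(K <#>\<^bsub>G\<^esub> H) \<inter> Hr = {\<one>\<^bsub>G\<^esub>}"
    using subgroup.one_closed[OF assms(2)] by blast
  then show "(K, H) \<in> Gamma_edges G Hr" using V by (auto simp: Gamma_edges_def)
qed

lemma conn_components_partition:
  assumes "sym E"
  shows "equiv V {(u, v). u \<in> V \<and> v \<in> V \<and> (u, v) \<in> E\<^sup>*}"
  using sym_rtrancl[OF assms]
  by (auto intro!: equivI refl_onI symI transI dest: symD intro: rtrancl_trans)

end

theory Submission
  imports Defs "HOL-Algebra.Multiplicative_Group"
begin

text \<open>
  A unit of the completion contains exactly one coset of every non-trivial subgroup and is closed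
  under passing to larger cosets. In a periodic group every non-trivial subgroup contains a minimal
  one, so a unit is determined by its cosets of minimal subgroups, and these form a family in
  $\mathcal{A}_G$; the inverse map is upward closure.

  If the minimal subgroups permute, they normalise each other, and compatibility of
  \<open>Ha\<close> and \<open>Kb\<close> means that the two cosets meet. Fix a component $\Gamma_0$ of $\Gamma(H_r)$
  and one of its vertices $H_0$. Translating on the right by the unique common element $g$ of the
  cosets of $H_r$ and $H_0$ in the family, every other coset is $H_i t_i g$ for a unique
  $t_i \in H_r$. Compatibility of two such cosets says $t_i t_j^{-1} \in H_iH_j \cap H_r$, which is
  $t_i = t_j$ along an edge of $\Gamma(H_r)$ and no condition otherwise, since then
  $H_r \subseteq H_iH_j$. Hence the family amounts to $g$ together with an arbitrary $H_r$-valued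
  function on the components other than $\Gamma_0$.
\<close>

section \<open>Compatibility of cosets\<close>

context group
begin

text \<open>The two conjuncts come from \<open>Ha\<close> times the inverse of \<open>Kb\<close> and
  from the inverse of \<open>Ha\<close> times \<open>Kb\<close>. Each product is a coset
  \<open>M #> c\<close>, which is idempotent exactly when it is a subgroup, that is, when c lies in
  M.\<close>

lemma K1_compatible_iff:
  assumes H: "nontriv_subgroup G H" "a \<in> carrier G" and K: "nontriv_subgroup G K" "b \<in> carrier G"
  shows "compatible (K1 G) (H #> a) (K #> b) \<longleftrightarrow>
    a \<otimes> inv b \<in> generate G (H \<union> conj_set G K (b \<otimes> inv a)) \<and>
    inv a \<otimes> b \<in> generate G (conj_set G H a \<union> conj_set G K a)"
proof -
  have s: "subgroup H G" "H \<subseteq> carrier G" "subgroup K G" "K \<subseteq> carrier G"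
    using H K by (auto dest: nontriv_subgroupD subgroup.subset)
  have idem: "M #> c \<in> idempotents (K1 G) \<longleftrightarrow> c \<in> M"
    if M: "nontriv_subgroup G M" "c \<in> carrier G" for M c
  proof
    have M': "subgroup M G" "M \<subseteq> carrier G" using M by (auto dest: nontriv_subgroupD subgroup.subset)
    show "c \<in> M" if "M #> c \<in> idempotents (K1 G)"
    proof -
      have N: "subgroup (M #> c) G" using that by (simp add: K1_idempotents nontriv_subgroup_def)
      \<comment> \<open>Writing the subgroup \<open>M #> c\<close> as a coset of itself lets
        \<open>coset_eq_iff\<close> identify it with M.\<close>
      then have "M #> c = (M #> c) #> \<one>" using subgroup.subset by fastforce
      then show ?thesis using coset_eq_iff[OF M'(1) N M(2) one_closed] M M' coset_join1 by metis
    qed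
    show "M #> c \<in> idempotents (K1 G)" if "c \<in> M"
      using that M M' coset_join2 by (simp add: K1_idempotents)
  qed
  have cK: "nontriv_subgroup G (conj_set G K b)" "nontriv_subgroup G (conj_set G H a)"
    using H K by (simp_all add: nontriv_conj)
  have "(H #> a) \<star>\<^bsub>K1 G\<^esub> (conj_set G K b #> inv b) =
      generate G (H \<union> conj_set G K (b \<otimes> inv a)) #> (a \<otimes> inv b)"
    using H K s cK by (simp add: K1_mult conj_set_mult)
  moreover have "(conj_set G H a #> inv a) \<star>\<^bsub>K1 G\<^esub> (K #> b) =
      generate G (conj_set G H a \<union> conj_set G K a) #> (inv a \<otimes> b)"
    using H K s cK by (simp add: K1_mult)
  moreover have "nontriv_subgroup G (generate G (H \<union> conj_set G K (b \<otimes> inv a)))"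
    "nontriv_subgroup G (generate G (conj_set G H a \<union> conj_set G K a))"
    using H K s cK conj_set_closed[OF s(4), of "b \<otimes> inv a"] conj_set_closed[OF s(4), of a]
    by (auto intro!: nontriv_product)
  ultimately show ?thesis
    using H K by (simp add: compatible_def K1_inv idem)
qed

text \<open>The generated subgroups in \<open>K1_compatible_iff\<close> grow with H and K, while the
  elements tested for membership depend only on a and b. This carries compatibility from cosets of
  minimal subgroups to the cosets containing them.\<close>

lemma K1_compatible_mono:
  assumes H: "nontriv_subgroup G H" "nontriv_subgroup G H'" "H \<subseteq> H'" "a \<in> carrier G"
    and K: "nontriv_subgroup G K" "nontriv_subgroup G K'" "K \<subseteq> K'" "b \<in> carrier G"
    and c: "compatible (K1 G) (H #> a) (K #> b)"
  shows "compatible (K1 G) (H' #> a) (K' #> b)"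
proof -
  have s: "conj_set G M g \<subseteq> conj_set G M' g" if "M \<subseteq> M'" for M M' g
    using that by (auto simp: conj_set_def)
  show ?thesis
    using c mono_generate[of "H \<union> conj_set G K (b \<otimes> inv a)" "H' \<union> conj_set G K' (b \<otimes> inv a)"]
      mono_generate[of "conj_set G H a \<union> conj_set G K a" "conj_set G H' a \<union> conj_set G K' a"]
      s[OF H(3)] s[OF K(3)] H K unfolding K1_compatible_iff[OF H(1,4) K(1,4)] K1_compatible_iff[OF H(2,4) K(2,4)]
    by (meson Un_mono subsetD)
qed

text \<open>If H^a = K^b, then conjugating K by b a^-1 gives H, so the first condition reduces to a
  b^-1 in H; hence K = H^(a b^-1) = H. Thus a set of pairwise compatible cosets meets each L-class
  at most once.\<close>

lemma K1_compatible_same_range: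
  assumes H: "nontriv_subgroup G H" "a \<in> carrier G" and K: "nontriv_subgroup G K" "b \<in> carrier G"
    and c: "compatible (K1 G) (H #> a) (K #> b)" and e: "conj_set G H a = conj_set G K b"
  shows "H #> a = K #> b"
proof -
  have s: "subgroup H G" "H \<subseteq> carrier G" "subgroup K G" "K \<subseteq> carrier G"
    using H K by (auto dest: nontriv_subgroupD subgroup.subset)
  have "conj_set G K (b \<otimes> inv a) = conj_set G (conj_set G H a) (inv a)"
    using s H K by (simp add: e conj_set_mult)
  also have "\<dots> = H" using s H by (simp add: conj_set_mult conj_set_one)
  finally have m: "a \<otimes> inv b \<in> H"
    using c s by (simp add: K1_compatible_iff[OF H K] generate_id)
  have "K = conj_set G (conj_set G H a) (inv b)"
    using s K by (simp add: e conj_set_mult conj_set_one)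
  also have "\<dots> = H" using s H K m by (simp add: conj_set_mult conj_set_self)
  finally show ?thesis
    using m s H K coset_eq_iff[OF s(1) s(1) K(2) H(2)] by metis
qed

text \<open>When both subgroups are H, the second condition reads a^-1 b in H^a, that is, b a^-1 in
  H. Pairwise compatible cosets therefore include at most one coset of each subgroup.\<close>

lemma K1_compatible_same_subgroup:
  assumes H: "nontriv_subgroup G H" "a \<in> carrier G" "b \<in> carrier G"
    and c: "compatible (K1 G) (H #> a) (H #> b)"
  shows "H #> a = H #> b"
proof -
  have s: "subgroup H G" "H \<subseteq> carrier G"
    using H by (auto dest: nontriv_subgroupD subgroup.subset)
  have "inv a \<otimes> b \<in> conj_set G H a"
    using c s H by (simp add: K1_compatible_iff generate_id conj_subgroup)
  then obtain h where h: "h \<in> H" "inv a \<otimes> b = inv a \<otimes> h \<otimes> a" by (auto simp: conj_set_def)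
  have "b = a \<otimes> (inv a \<otimes> b)" using H by simp
  also have "\<dots> = h \<otimes> a" using h s H by (simp add: m_assoc subset_iff)
  finally have "b = h \<otimes> a" .
  then have "b \<otimes> inv a \<in> H" using h s H by (simp add: m_assoc subset_iff)
  then show ?thesis using coset_eq_iff s H by blast
qed

section \<open>Permuting subgroups\<close>

lemma subgroup_set_mult:
  assumes "subgroup H G" "subgroup K G" "H <#> K = K <#> H"
  shows "subgroup (H <#> K) G"
proof (rule subgroupI)
  have s: "H \<subseteq> carrier G" "K \<subseteq> carrier G" using assms by (auto dest: subgroup.subset)
  show "H <#> K \<subseteq> carrier G" using s by (rule set_mult_closed)
  show "H <#> K \<noteq> {}" using assms by (auto simp: set_mult_def dest: subgroup.one_closed)
  fix x assume "x \<in> H <#> K"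
  then obtain h k where x: "h \<in> H" "k \<in> K" "x = h \<otimes> k" by (auto simp: set_mult_def)
  then have "inv x = inv k \<otimes> inv h" using s by (simp add: inv_mult_group subset_iff)
  moreover have "inv h \<in> H" "inv k \<in> K" using x assms by (auto intro: subgroup.m_inv_closed)
  ultimately show "inv x \<in> H <#> K" unfolding assms(3) by (auto simp: set_mult_def)
  fix y assume "y \<in> H <#> K"
  then obtain h' k' where y: "h' \<in> H" "k' \<in> K" "y = h' \<otimes> k'" by (auto simp: set_mult_def)
  \<comment> \<open>In (h k)(h' k') the inner product k h' lies in KH = HK; rewriting it as h'' k''
    sorts the factors.\<close>
  have "k \<otimes> h' \<in> H <#> K" unfolding assms(3) using x y by (auto simp: set_mult_def)
  then obtain h'' k'' where z: "h'' \<in> H" "k'' \<in> K" "k \<otimes> h' = h'' \<otimes> k''" by (auto simp: set_mult_def)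
  have c: "h \<in> carrier G" "h' \<in> carrier G" "h'' \<in> carrier G"
     "k \<in> carrier G" "k' \<in> carrier G" "k'' \<in> carrier G" using x y z s by auto
  have "x \<otimes> y = h \<otimes> (k \<otimes> h') \<otimes> k'" using x y c by (simp add: m_assoc)
  also have "\<dots> = (h \<otimes> h'') \<otimes> (k'' \<otimes> k')" using z c by (simp add: m_assoc)
  finally show "x \<otimes> y \<in> H <#> K"
    using x y z assms(1,2) by (auto simp: set_mult_def dest: subgroup.m_closed)
qed

lemma generate_Un_permuting:
  assumes H: "subgroup H G" and K: "subgroup K G" and HK: "H <#> K = K <#> H"
  shows "generate G (H \<union> K) = H <#> K"
proof -
  have s: "H \<subseteq> carrier G" "K \<subseteq> carrier G" using H K by (auto dest: subgroup.subset)
  have "H \<union> K \<subseteq> H <#> K"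
    using s subgroup.one_closed[OF H] subgroup.one_closed[OF K]
    by (auto simp: set_mult_def) (metis l_one r_one subsetD)+
  then have "generate G (H \<union> K) \<subseteq> H <#> K"
    by (rule generate_subgroup_incl[OF _ subgroup_set_mult[OF assms]])
  moreover have "H <#> K \<subseteq> generate G (H \<union> K)"
    by (auto simp: set_mult_def intro!: generate.eng intro: generate.incl)
  ultimately show ?thesis by simp
qed

text \<open>Forwards, the second condition puts a^-1 b in (KH)^a, so b = k h a and the cosets share
  the element h a = k^-1 b. Backwards, h a = k b gives b a^-1 = k^-1 h, and both conditions become
  memberships in the subgroup generated by H and K, the second one after conjugation by a.\<close>

lemma K1_compatible_permuting:
  assumes H: "nontriv_subgroup G H" "a \<in> carrier G" and K: "nontriv_subgroup G K" "b \<in> carrier G"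
    and HK: "H <#> K = K <#> H"
  shows "compatible (K1 G) (H #> a) (K #> b) \<longleftrightarrow> (\<exists>h\<in>H. \<exists>k\<in>K. h \<otimes> a = k \<otimes> b)"
proof
  have s: "subgroup H G" "H \<subseteq> carrier G" "subgroup K G" "K \<subseteq> carrier G"
    using H K by (auto dest: nontriv_subgroupD subgroup.subset)
  have gen: "generate G (H \<union> K) = K <#> H"
    using generate_Un_permuting[OF s(1,3) HK] HK by simp
  have conj: "generate G (conj_set G H a \<union> conj_set G K a) = conj_set G (generate G (H \<union> K)) a"
    using H s by (simp add: conj_generate conj_set_Un)
  {
    assume "compatible (K1 G) (H #> a) (K #> b)"
    then have "inv a \<otimes> b \<in> conj_set G (K <#> H) a"
      using H K by (simp add: K1_compatible_iff conj gen)
    then obtain k h where hk: "h \<in> H" "k \<in> K" "inv a \<otimes> b = inv a \<otimes> (k \<otimes> h) \<otimes> a"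
      by (auto simp: conj_set_def set_mult_def)
    then have c: "h \<in> carrier G" "k \<in> carrier G" using s by auto
    have "b = a \<otimes> (inv a \<otimes> b)" using H K by simp
    also have "\<dots> = k \<otimes> (h \<otimes> a)" unfolding hk(3) using c H by (simp add: m_assoc)
    finally have "h \<otimes> a = inv k \<otimes> b" using c H by simp
    then show "\<exists>h\<in>H. \<exists>k\<in>K. h \<otimes> a = k \<otimes> b"
      using hk s subgroup.m_inv_closed by metis
  }
  assume "\<exists>h\<in>H. \<exists>k\<in>K. h \<otimes> a = k \<otimes> b"
  then obtain h k where hk: "h \<in> H" "k \<in> K" "h \<otimes> a = k \<otimes> b" by blast
  then have c: "h \<in> carrier G" "k \<in> carrier G" "inv h \<in> H" "inv k \<in> K"
    using s by (auto intro: subgroup.m_inv_closed)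
  have "b = inv k \<otimes> (k \<otimes> b)" using c K by simp
  also have "\<dots> = (inv k \<otimes> h) \<otimes> a" using c H by (simp add: hk(3)[symmetric] m_assoc)
  finally have b: "b = (inv k \<otimes> h) \<otimes> a" .
  have ba: "b \<otimes> inv a = inv k \<otimes> h" unfolding b using c H by (simp add: m_assoc)
  have ab: "a \<otimes> inv b = inv h \<otimes> k" unfolding b using c H by (simp add: m_assoc inv_mult_group)
  \<comment> \<open>Conjugation by k^-1 fixes K, and further conjugation by h in H does not change
    the subgroup generated together with H.\<close>
  have "generate G (H \<union> conj_set G K (b \<otimes> inv a)) = generate G (H \<union> K)"
    using generate_conj_mem[OF s(1) hk(1) s(4)] conj_set_self[OF s(3) c(4)] s c
    by (simp add: ba conj_set_mult[symmetric])
  moreover have "inv h \<otimes> k \<in> generate G (H \<union> K)"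
    using c hk by (auto intro!: generate.eng intro: generate.incl)
  moreover have "inv a \<otimes> b \<in> conj_set G (generate G (H \<union> K)) a"
  proof -
    have "inv k \<otimes> h \<in> generate G (H \<union> K)"
      using c hk by (auto intro!: generate.eng intro: generate.incl)
    moreover have "inv a \<otimes> b = inv a \<otimes> (inv k \<otimes> h) \<otimes> a" using b c H by (simp add: m_assoc)
    ultimately show ?thesis by (auto simp: conj_set_def)
  qed
  ultimately show "compatible (K1 G) (H #> a) (K #> b)"
    using H K by (simp add: K1_compatible_iff ab conj)
qed

section \<open>Minimal subgroups\<close>

lemma minimal_subgroupsD:
  assumes "H \<in> minimal_subgroups G"
  shows "nontriv_subgroup G H" "subgroup H G" "H \<subseteq> carrier G"
  using assms by (auto simp: minimal_subgroups_def nontriv_subgroup_def dest: subgroup.subset)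

lemma minimal_subgroups_conj:
  assumes "H \<in> minimal_subgroups G" "g \<in> carrier G"
  shows "conj_set G H g \<in> minimal_subgroups G"
proof -
  note H = minimal_subgroupsD[OF assms(1)]
  have "K = conj_set G H g" if K: "nontriv_subgroup G K" "K \<subseteq> conj_set G H g" for K
  proof -
    have Ks: "K \<subseteq> carrier G" using K by (auto dest: nontriv_subgroupD subgroup.subset)
    have "conj_set G K (inv g) \<subseteq> conj_set G (conj_set G H g) (inv g)"
      using K unfolding conj_set_def by blast
    then have "conj_set G K (inv g) \<subseteq> H"
      using H assms by (simp add: conj_set_mult conj_set_one)
    then have "conj_set G K (inv g) = H"
      using assms K nontriv_conj by (auto simp: minimal_subgroups_def)
    then have "conj_set G H g = conj_set G (conj_set G K (inv g)) g" by simp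
    then show ?thesis using Ks assms by (simp add: conj_set_mult conj_set_one)
  qed
  then show ?thesis using H assms by (simp add: minimal_subgroups_def nontriv_conj)
qed

text \<open>By minimality the non-trivial subgroup \<open>H \<inter> K\<close> is all of H. So a
  minimal subgroup meets any subgroup trivially or lies inside it; applied to \<open>Hr\<close> and
  HK, this is the dichotomy between edges and non-edges of the graph.\<close>

lemma minimal_subgroup_Int:
  assumes "H \<in> minimal_subgroups G" "subgroup K G" "H \<inter> K \<noteq> {\<one>}"
  shows "H \<subseteq> K"
proof -
  have "nontriv_subgroup G (H \<inter> K)"
    using assms minimal_subgroupsD[OF assms(1)] by (simp add: nontriv_subgroup_def subgroups_Inter_pair)
  then have "H \<inter> K = H" using assms(1) by (auto simp: minimal_subgroups_def)
  then show ?thesis by blast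
qed

lemma minimal_subgroups_Int:
  assumes "H \<in> minimal_subgroups G" "K \<in> minimal_subgroups G" "H \<noteq> K"
  shows "H \<inter> K = {\<one>}"
proof (rule ccontr)
  assume n: "H \<inter> K \<noteq> {\<one>}"
  then have "H \<subseteq> K" "K \<subseteq> H"
    using minimal_subgroup_Int[OF assms(1) minimal_subgroupsD(2)[OF assms(2)]]
      minimal_subgroup_Int[OF assms(2) minimal_subgroupsD(2)[OF assms(1)]] by (simp_all add: Int_commute)
  then show False using assms(3) by simp
qed

text \<open>A non-trivial element of K has finite order, so K has a finite non-trivial subgroup. One
  of least order among these is minimal, since its own subgroups are finite too.\<close>

lemma periodic_minimal_subgroup:
  assumes "periodic_group G" "nontriv_subgroup G K"
  obtains H where "H \<in> minimal_subgroups G" "H \<subseteq> K"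
proof -
  have K: "subgroup K G" "K \<subseteq> carrier G" using assms by (auto dest: nontriv_subgroupD subgroup.subset)
  obtain x where x: "x \<in> K" "x \<noteq> \<one>"
    using assms(2) K(1) subgroup.one_closed unfolding nontriv_subgroup_def by blast
  let ?P = "\<lambda>H. nontriv_subgroup G H \<and> finite H \<and> H \<subseteq> K"
  have xG: "x \<in> carrier G" using x K by auto
  then obtain n :: nat where "n > 0" "x [^] n = \<one>"
    using assms(1) by (auto simp: periodic_group_def)
  then have "ord x > 0" using pow_eq_id[OF xG, of n] by (auto intro: ccontr)
  then have "finite (generate G {x})" using generate_pow_card[OF xG] by (metis card_ge_0_finite)
  moreover have "generate G {x} \<subseteq> K" using x K by (intro generate_subgroup_incl) auto
  moreover have "nontriv_subgroup G (generate G {x})"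
  proof -
    have "x \<in> generate G {x}" by (simp add: generate.incl)
    then show ?thesis using x xG generate_is_subgroup[of "{x}"] unfolding nontriv_subgroup_def by blast
  qed
  ultimately have "?P (generate G {x})" by blast
  then have "\<exists>H. ?P H \<and> (\<forall>L. ?P L \<longrightarrow> card H \<le> card L)"
    by (rule ex_has_least_nat[of ?P])
  then obtain H where H: "?P H" and min: "\<And>L. ?P L \<longrightarrow> card H \<le> card L"
    by (elim exE conjE) (rule that, blast+)
  have "L = H" if "nontriv_subgroup G L" "L \<subseteq> H" for L
    using H min[of L] that by (metis card_seteq finite_subset subset_trans)
  then have "H \<in> minimal_subgroups G" using H by (simp add: minimal_subgroups_def)
  then show ?thesis using H that by blast
qed

section \<open>Units of the completion\<close>

lemma K1_L_class:
  assumes "nontriv_subgroup G H" "nontriv_subgroup G K" "a \<in> carrier G"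
  shows "K #> a \<in> L_class (K1 G) H \<longleftrightarrow> conj_set G K a = H"
proof -
  have "H \<subseteq> carrier G" using assms by (auto dest: nontriv_subgroupD subgroup.subset)
  then show ?thesis
    using K1_green_L[OF assms(1) one_closed assms(2,3)] assms
    by (auto simp: L_class_def K1_mem conj_set_one)
qed

section \<open>Families as sets of cosets\<close>

definition minimal_cosets :: "'a set set" where
  "minimal_cosets = {H #> a | H a. H \<in> minimal_subgroups G \<and> a \<in> carrier G}"

text \<open>Compatibility already gives at most one coset for each minimal subgroup and at most one
  in each L-class. Hence the choice function and the cardinality condition can be traded for two
  existence statements, one for the subgroup H of a coset \<open>Ha\<close> and one for H^a.\<close>

lemma A_families_iff:
  "F \<in> A_families G \<longleftrightarrow>
    F \<subseteq> minimal_cosets \<and>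
    (\<forall>X\<in>F. \<forall>Y\<in>F. compatible (K1 G) X Y) \<and>
    (\<forall>H\<in>minimal_subgroups G. \<exists>a\<in>carrier G. H #> a \<in> F) \<and>
    (\<forall>H\<in>minimal_subgroups G. \<exists>K\<in>minimal_subgroups G. \<exists>a\<in>carrier G. K #> a \<in> F \<and> conj_set G K a = H)"
  (is "_ \<longleftrightarrow> ?cosets \<and> ?compat \<and> ?dom \<and> ?ran")
proof
  assume "F \<in> A_families G"
  then obtain a where a: "a \<in> minimal_subgroups G \<rightarrow> carrier G"
    and F: "F = (\<lambda>H. H #> a H) ` minimal_subgroups G"
    and c: "\<And>H K. H \<in> minimal_subgroups G \<Longrightarrow> K \<in> minimal_subgroups G \<Longrightarrow>
      compatible (K1 G) (H #> a H) (K #> a K)"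
    and one: "\<And>H. H \<in> minimal_subgroups G \<Longrightarrow> card (F \<inter> L_class (K1 G) H) = 1"
    unfolding A_families_def by blast
  have "\<exists>K\<in>minimal_subgroups G. \<exists>a\<in>carrier G. K #> a \<in> F \<and> conj_set G K a = H"
    if H: "H \<in> minimal_subgroups G" for H
  proof -
    obtain X where X: "X \<in> F" "X \<in> L_class (K1 G) H"
      using one[OF H] by (metis Int_iff card.empty equals0I zero_neq_one)
    then obtain K where K: "K \<in> minimal_subgroups G" "X = K #> a K" using F by blast
    moreover have "a K \<in> carrier G" using a K by blast
    ultimately show ?thesis
      using X K1_L_class[OF minimal_subgroupsD(1)[OF H] minimal_subgroupsD(1)[OF K(1)]] by blast
  qed
  moreover have "?cosets" "?dom" unfolding F minimal_cosets_def using a by blast+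
  ultimately show "?cosets \<and> ?compat \<and> ?dom \<and> ?ran" using c by (auto simp: F)
next
  assume "?cosets \<and> ?compat \<and> ?dom \<and> ?ran"
  then have cosets: ?cosets and compat: ?compat and dom: ?dom and ran: ?ran by simp_all
  have "\<forall>H\<in>minimal_subgroups G. \<exists>b. b \<in> carrier G \<and> H #> b \<in> F" using dom by blast
  from bchoice[OF this] obtain a where a: "\<And>H. H \<in> minimal_subgroups G \<Longrightarrow> a H \<in> carrier G"
    "\<And>H. H \<in> minimal_subgroups G \<Longrightarrow> H #> a H \<in> F" by blast
  have F: "F = (\<lambda>H. H #> a H) ` minimal_subgroups G"
  proof
    show "F \<subseteq> (\<lambda>H. H #> a H) ` minimal_subgroups G"
    proof
      fix X assume X: "X \<in> F"
      then obtain H b where H: "H \<in> minimal_subgroups G" "b \<in> carrier G" "X = H #> b"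
        using cosets by (auto simp: minimal_cosets_def)
      moreover have "compatible (K1 G) X (H #> a H)" using X H a compat by blast
      ultimately have "X = H #> a H"
        using K1_compatible_same_subgroup[OF minimal_subgroupsD(1)[OF H(1)] H(2) a(1)[OF H(1)]] by simp
      then show "X \<in> (\<lambda>H. H #> a H) ` minimal_subgroups G" using H by blast
    qed
  qed (use a in auto)
  have "card (F \<inter> L_class (K1 G) H) = 1" if H: "H \<in> minimal_subgroups G" for H
  proof -
    obtain K b where K: "K \<in> minimal_subgroups G" "b \<in> carrier G" "K #> b \<in> F" "conj_set G K b = H"
      using ran H by blast
    have "X = K #> b" if X: "X \<in> F" "X \<in> L_class (K1 G) H" for X
    proof -
      obtain L c where L: "L \<in> minimal_subgroups G" "c \<in> carrier G" "X = L #> c"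
        using cosets X by (auto simp: minimal_cosets_def)
      then have "conj_set G L c = conj_set G K b"
        using X K H K1_L_class minimal_subgroupsD(1) by metis
      then show ?thesis
        using K1_compatible_same_range[OF minimal_subgroupsD(1)[OF L(1)] L(2) minimal_subgroupsD(1)[OF K(1)] K(2)]
          L(3) X K compat by blast
    qed
    moreover have "K #> b \<in> L_class (K1 G) H"
      using K H K1_L_class minimal_subgroupsD(1) by metis
    ultimately have "F \<inter> L_class (K1 G) H = {K #> b}" using K by blast
    then show ?thesis by simp
  qed
  then show "F \<in> A_families G"
    unfolding A_families_def using a compat F by (auto intro!: exI[of _ a])
qed


lemma A_familiesD:
  assumes "F \<in> A_families G"
  shows "F \<subseteq> minimal_cosets"
    and "\<And>X Y. X \<in> F \<Longrightarrow> Y \<in> F \<Longrightarrow> compatible (K1 G) X Y"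
    and "\<And>H. H \<in> minimal_subgroups G \<Longrightarrow> \<exists>a\<in>carrier G. H #> a \<in> F"
    and "\<And>H. H \<in> minimal_subgroups G \<Longrightarrow>
      \<exists>K\<in>minimal_subgroups G. \<exists>a\<in>carrier G. K #> a \<in> F \<and> conj_set G K a = H"
  using assms unfolding A_families_iff by simp_all

section \<open>Natural order and inversion\<close>

text \<open>An idempotent M times \<open>K #> b\<close> is the coset with the same representative b
  of the subgroup generated by M and K. Going down in the natural order thus enlarges the subgroup
  and can keep the representative.\<close>

lemma K1_natural_leD:
  assumes "natural_le (K1 G) X (K #> b)" "X \<in> carrier (K1 G)" "nontriv_subgroup G K" "b \<in> carrier G"
  obtains H where "nontriv_subgroup G H" "K \<subseteq> H" "X = H #> b"
proof -
  have K: "subgroup K G" "K \<subseteq> carrier G" using assms by (auto dest: nontriv_subgroupD subgroup.subset)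
  obtain M where M: "nontriv_subgroup G M" "X = M \<star>\<^bsub>K1 G\<^esub> (K #> b)"
    using assms by (auto simp: natural_le_def K1_idempotents)
  then have "X = generate G (M \<union> K) #> b" using assms K1_mult_subgroup by simp
  moreover have "nontriv_subgroup G (generate G (M \<union> K))" using M K by (simp add: nontriv_product)
  moreover have "K \<subseteq> generate G (M \<union> K)" by (auto intro: generate.incl)
  ultimately show ?thesis using that by blast
qed

lemma K1_up_mem:
  assumes A: "permissible (K1 G) A" and H: "H #> a \<in> A" "nontriv_subgroup G H" "a \<in> carrier G"
    and K: "nontriv_subgroup G K" "H \<subseteq> K"
  shows "K #> a \<in> A"
proof -
  have "H #> a \<subseteq> K #> a" using K by (auto simp: r_coset_def)
  then have "natural_le (K1 G) (K #> a) (H #> a)"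
    using H K by (simp add: K1_natural_le K1_mem)
  then show ?thesis using A H K K1_mem unfolding permissible_def by blast
qed

lemma K1_inv_closed: "X \<in> carrier (K1 G) \<Longrightarrow> sg_inv (K1 G) X \<in> carrier (K1 G)"
  by (auto elim!: K1_cases simp: K1_inv K1_mem nontriv_conj)

lemma K1_inv_inv:
  assumes "X \<in> carrier (K1 G)"
  shows "sg_inv (K1 G) (sg_inv (K1 G) X) = X"
proof -
  obtain H a where X: "nontriv_subgroup G H" "a \<in> carrier G" "X = H #> a"
    using assms K1_cases by metis
  then have "H \<subseteq> carrier G" by (auto dest: nontriv_subgroupD subgroup.subset)
  then show ?thesis using X by (simp add: K1_inv nontriv_conj conj_set_mult conj_set_one)
qed

text \<open>The inverse H^a a^-1 is the left coset a^-1 H, the set of inverses of the elements of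
  \<open>Ha\<close>. In this form inversion visibly preserves inclusion of cosets, hence the natural
  order.\<close>

lemma K1_inv_eq_image:
  assumes "X \<in> carrier (K1 G)"
  shows "sg_inv (K1 G) X = m_inv G ` X"
proof -
  obtain H a where X: "nontriv_subgroup G H" "a \<in> carrier G" "X = H #> a"
    using assms K1_cases by metis
  then have H: "subgroup H G" "H \<subseteq> carrier G" by (auto dest: nontriv_subgroupD subgroup.subset)
  have "inv a \<otimes> h \<otimes> a \<otimes> inv a = inv (inv h \<otimes> a)" if "h \<in> H" for h
    using that H X by (simp add: m_assoc inv_mult_group subset_iff)
  then have e: "conj_set G H a #> inv a = (\<lambda>h. inv (inv h \<otimes> a)) ` H"
    by (auto simp: conj_set_def r_coset_def)
  have "m_inv G ` H = H"
  proof
    show "m_inv G ` H \<subseteq> H" using H by (auto intro: subgroup.m_inv_closed)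
    show "H \<subseteq> m_inv G ` H"
    proof
      fix x assume "x \<in> H"
      then have "inv x \<in> H" "x = inv (inv x)" using H by (auto intro: subgroup.m_inv_closed)
      then show "x \<in> m_inv G ` H" by blast
    qed
  qed
  then have "(\<lambda>h. inv (inv h \<otimes> a)) ` H = (\<lambda>h. inv (h \<otimes> a)) ` H"
    using image_image[of "\<lambda>h. inv (h \<otimes> a)" "m_inv G" H] by simp
  moreover have "m_inv G ` X = (\<lambda>h. inv (h \<otimes> a)) ` H" by (auto simp: X(3) r_coset_def)
  ultimately show ?thesis using X by (simp add: K1_inv e)
qed

text \<open>Inversion is an involution that preserves the natural order, and it exchanges the two
  conditions in the definition of compatibility. The image of a unit under it will serve as the
  inverse of that unit.\<close>

lemma permissible_K1_inv:
  assumes A: "permissible (K1 G) A"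
  shows "permissible (K1 G) (sg_inv (K1 G) ` A)"
proof -
  have A': "A \<subseteq> carrier (K1 G)" "\<And>X Y. X \<in> A \<Longrightarrow> Y \<in> A \<Longrightarrow> compatible (K1 G) X Y"
    "\<And>X Y. Y \<in> A \<Longrightarrow> X \<in> carrier (K1 G) \<Longrightarrow> natural_le (K1 G) X Y \<Longrightarrow> X \<in> A"
    using A unfolding permissible_def by blast+
  have "X \<in> sg_inv (K1 G) ` A"
    if Y: "Y \<in> A" and X: "X \<in> carrier (K1 G)" and le: "natural_le (K1 G) X (sg_inv (K1 G) Y)" for X Y
  proof -
    have Yc: "Y \<in> carrier (K1 G)" using Y A' by blast
    have "sg_inv (K1 G) Y \<subseteq> X" using le X Yc by (simp add: K1_natural_le K1_inv_closed)
    then have "sg_inv (K1 G) (sg_inv (K1 G) Y) \<subseteq> sg_inv (K1 G) X"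
      using X Yc K1_inv_eq_image K1_inv_closed by (metis image_mono)
    then have "natural_le (K1 G) (sg_inv (K1 G) X) Y"
      using X Yc by (simp add: K1_inv_inv K1_natural_le K1_inv_closed)
    then have "sg_inv (K1 G) X \<in> A" using A'(3)[OF Y] X K1_inv_closed by blast
    then show ?thesis using X by (metis K1_inv_inv image_eqI)
  qed
  moreover have "compatible (K1 G) (sg_inv (K1 G) X) (sg_inv (K1 G) Y)" if "X \<in> A" "Y \<in> A" for X Y
    using A'(2)[OF that] A'(1) that K1_inv_inv by (auto simp: compatible_def subset_iff)
  ultimately show ?thesis
    unfolding permissible_def using A'(1) K1_inv_closed by blast
qed

section \<open>Characterisation of the units\<close>

text \<open>For X = \<open>Ha\<close> the idempotents X X^-1 and X^-1 X are H and H^a. The two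
  conditions beside permissibility say that each of these runs through all non-trivial subgroups as
  X runs through A.\<close>

lemma Sigma_group_K1_iff:
  "A \<in> carrier (Sigma_group (K1 G)) \<longleftrightarrow> permissible (K1 G) A \<and>
    (\<forall>H. nontriv_subgroup G H \<longrightarrow> (\<exists>a\<in>carrier G. H #> a \<in> A)) \<and>
    (\<forall>H. nontriv_subgroup G H \<longrightarrow>
      (\<exists>K. nontriv_subgroup G K \<and> (\<exists>a\<in>carrier G. K #> a \<in> A \<and> conj_set G K a = H)))"
  (is "_ \<longleftrightarrow> _ \<and> ?dom \<and> ?ran")
proof
  have sg: "A \<in> carrier (Sigma_group (K1 G)) \<longleftrightarrow> permissible (K1 G) A \<and> (\<exists>B. permissible (K1 G) B \<and>
    {X \<star>\<^bsub>K1 G\<^esub> Y |X Y. X \<in> A \<and> Y \<in> B} = {H. nontriv_subgroup G H} \<and>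
    {Y \<star>\<^bsub>K1 G\<^esub> X |Y X. Y \<in> B \<and> X \<in> A} = {H. nontriv_subgroup G H})"
    by (auto simp: Sigma_group_def units_of_def Units_def completion_def K1_idempotents)
  {
    assume "A \<in> carrier (Sigma_group (K1 G))"
    then obtain B where A: "permissible (K1 G) A" and B: "permissible (K1 G) B"
      and AB: "{X \<star>\<^bsub>K1 G\<^esub> Y |X Y. X \<in> A \<and> Y \<in> B} = {H. nontriv_subgroup G H}"
      and BA: "{Y \<star>\<^bsub>K1 G\<^esub> X |Y X. Y \<in> B \<and> X \<in> A} = {H. nontriv_subgroup G H}"
      unfolding sg by (elim conjE exE) (rule that)
    have c: "A \<subseteq> carrier (K1 G)" "B \<subseteq> carrier (K1 G)"
      using A B by (auto simp: permissible_def)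
    \<comment> \<open>The product is a coset of the subgroup generated by K and L^(a^-1), with
      representative a b. Comparing it with \<open>H #> \<one>\<close> identifies that subgroup with
      H and puts a b into H.\<close>
    have prod: "K \<subseteq> H \<and> conj_set G L (inv a) \<subseteq> H \<and> a \<otimes> b \<in> H"
      if H: "nontriv_subgroup G H" "(K #> a) \<star>\<^bsub>K1 G\<^esub> (L #> b) = H"
        and KL: "nontriv_subgroup G K" "nontriv_subgroup G L" "a \<in> carrier G" "b \<in> carrier G"
      for H K L a b
    proof -
      have HG: "subgroup H G" using H(1) by (rule nontriv_subgroupD)
      have H1: "H #> \<one> = H" using subgroup.subset[OF HG] by (rule coset_mult_one)
      let ?M = "generate G (K \<union> conj_set G L (inv a))"
      have M: "subgroup ?M G" using KL by (intro nontriv_subgroupD K1_mult_nontriv)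
      have "?M #> (a \<otimes> b) = H #> \<one>" using H(2) KL H1 by (simp add: K1_mult)
      then have "?M = H" "\<one> \<otimes> inv (a \<otimes> b) \<in> H"
        using coset_eq_iff[OF M HG, of "a \<otimes> b" \<one>] KL by auto
      moreover from this have "a \<otimes> b \<in> H"
        using subgroup.m_inv_closed[OF HG, of "inv (a \<otimes> b)"] KL by simp
      moreover have "K \<union> conj_set G L (inv a) \<subseteq> ?M" by (auto intro: generate.incl)
      ultimately show ?thesis by auto
    qed
    have ?dom
    proof (intro allI impI)
      fix H assume H: "nontriv_subgroup G H"
      then have "H \<in> {X \<star>\<^bsub>K1 G\<^esub> Y |X Y. X \<in> A \<and> Y \<in> B}" unfolding AB by simp
      then obtain X Y where XY: "X \<in> A" "Y \<in> B" "X \<star>\<^bsub>K1 G\<^esub> Y = H" by blast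
      obtain K a where X: "nontriv_subgroup G K" "a \<in> carrier G" "X = K #> a"
        using XY c K1_cases by blast
      obtain L b where Y: "nontriv_subgroup G L" "b \<in> carrier G" "Y = L #> b"
        using XY c K1_cases by blast
      have "K \<subseteq> H" using prod[of H K a L b] H XY(3) X Y by simp
      then show "\<exists>a\<in>carrier G. H #> a \<in> A" using K1_up_mem[OF A] XY X H by blast
    qed
    moreover have ?ran
    proof (intro allI impI)
      fix H assume H: "nontriv_subgroup G H"
      then have "H \<in> {Y \<star>\<^bsub>K1 G\<^esub> X |Y X. Y \<in> B \<and> X \<in> A}" unfolding BA by simp
      then obtain X Y where XY: "X \<in> A" "Y \<in> B" "Y \<star>\<^bsub>K1 G\<^esub> X = H" by blast
      obtain K a where X: "nontriv_subgroup G K" "a \<in> carrier G" "X = K #> a"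
        using XY c K1_cases by blast
      obtain L b where Y: "nontriv_subgroup G L" "b \<in> carrier G" "Y = L #> b"
        using XY c K1_cases by blast
      have m: "conj_set G K (inv b) \<subseteq> H" "b \<otimes> a \<in> H" using prod[of H L b K a] H XY(3) X Y by simp_all
      have s: "subgroup H G" "H \<subseteq> carrier G" "K \<subseteq> carrier G"
        using H X by (auto dest: nontriv_subgroupD subgroup.subset)
      have "conj_set G (conj_set G K (inv b)) b \<subseteq> conj_set G H b" using m by (auto simp: conj_set_def)
      then have "K \<subseteq> conj_set G H b" using s Y by (simp add: conj_set_mult conj_set_one)
      \<comment> \<open>The witness is \<open>Ka\<close> enlarged to H^b a; since b a lies in H,
        conjugating H^b by a gives back H.\<close>
      then have "conj_set G H b #> a \<in> A" using K1_up_mem[OF A] XY X Y H nontriv_conj by blast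
      moreover have "conj_set G (conj_set G H b) a = H"
        using conj_set_self[OF s(1) m(2)] s X Y by (simp add: conj_set_mult)
      ultimately show "\<exists>K. nontriv_subgroup G K \<and> (\<exists>a\<in>carrier G. K #> a \<in> A \<and> conj_set G K a = H)"
        using X Y H nontriv_conj by blast
    qed
    ultimately show "permissible (K1 G) A \<and> ?dom \<and> ?ran" using A by blast
  }
  assume "permissible (K1 G) A \<and> ?dom \<and> ?ran"
  then have A: "permissible (K1 G) A" and A_dom: ?dom and A_ran: ?ran by simp_all
  then have cp: "\<And>X Y. X \<in> A \<Longrightarrow> Y \<in> A \<Longrightarrow> compatible (K1 G) X Y"
    by (simp add: permissible_def)
  \<comment> \<open>The set of inverses is a two-sided inverse of A: compatibility makes all mixed
    products idempotent, and the products of a member with its own inverse reach every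
    idempotent.\<close>
  let ?B = "sg_inv (K1 G) ` A"
  have dom: "(H #> a) \<star>\<^bsub>K1 G\<^esub> sg_inv (K1 G) (H #> a) = H"
    and ran: "sg_inv (K1 G) (H #> a) \<star>\<^bsub>K1 G\<^esub> (H #> a) = conj_set G H a"
    if H: "nontriv_subgroup G H" "a \<in> carrier G" for H a
  proof -
    have "subgroup H G" "H \<subseteq> carrier G" "nontriv_subgroup G (conj_set G H a)"
      using H by (auto intro: nontriv_conj dest: nontriv_subgroupD subgroup.subset)
    then show "(H #> a) \<star>\<^bsub>K1 G\<^esub> sg_inv (K1 G) (H #> a) = H"
      "sg_inv (K1 G) (H #> a) \<star>\<^bsub>K1 G\<^esub> (H #> a) = conj_set G H a"
      using H by (simp_all add: K1_inv K1_mult conj_set_mult conj_set_one generate_id conj_subgroup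
        conj_set_closed)
  qed
  have "{X \<star>\<^bsub>K1 G\<^esub> Y |X Y. X \<in> A \<and> Y \<in> ?B} = {H. nontriv_subgroup G H}"
  proof
    show "{X \<star>\<^bsub>K1 G\<^esub> Y |X Y. X \<in> A \<and> Y \<in> ?B} \<subseteq> {H. nontriv_subgroup G H}"
      using cp by (auto simp: compatible_def K1_idempotents)
    show "{H. nontriv_subgroup G H} \<subseteq> {X \<star>\<^bsub>K1 G\<^esub> Y |X Y. X \<in> A \<and> Y \<in> ?B}"
    proof
      fix H assume "H \<in> {H. nontriv_subgroup G H}"
      then have H: "nontriv_subgroup G H" by simp
      then obtain a where a: "a \<in> carrier G" "H #> a \<in> A" using A_dom by blast
      then have "H = (H #> a) \<star>\<^bsub>K1 G\<^esub> sg_inv (K1 G) (H #> a)" using dom H by simp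
      then show "H \<in> {X \<star>\<^bsub>K1 G\<^esub> Y |X Y. X \<in> A \<and> Y \<in> ?B}" using a by blast
    qed
  qed
  moreover have "{Y \<star>\<^bsub>K1 G\<^esub> X |Y X. Y \<in> ?B \<and> X \<in> A} = {H. nontriv_subgroup G H}"
  proof
    show "{Y \<star>\<^bsub>K1 G\<^esub> X |Y X. Y \<in> ?B \<and> X \<in> A} \<subseteq> {H. nontriv_subgroup G H}"
      using cp by (auto simp: compatible_def K1_idempotents)
    show "{H. nontriv_subgroup G H} \<subseteq> {Y \<star>\<^bsub>K1 G\<^esub> X |Y X. Y \<in> ?B \<and> X \<in> A}"
    proof
      fix H assume "H \<in> {H. nontriv_subgroup G H}"
      then have H: "nontriv_subgroup G H" by simp
      then obtain K a where a: "nontriv_subgroup G K" "a \<in> carrier G" "K #> a \<in> A" "conj_set G K a = H"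
        using A_ran by blast
      then have "H = sg_inv (K1 G) (K #> a) \<star>\<^bsub>K1 G\<^esub> (K #> a)" using ran by simp
      then show "H \<in> {Y \<star>\<^bsub>K1 G\<^esub> X |Y X. Y \<in> ?B \<and> X \<in> A}" using a by blast
    qed
  qed
  ultimately show "A \<in> carrier (Sigma_group (K1 G))"
    unfolding sg using A permissible_K1_inv[OF A] by (intro conjI exI[of _ ?B])
qed

lemma Sigma_group_K1D:
  assumes "A \<in> carrier (Sigma_group (K1 G))"
  shows "permissible (K1 G) A"
    and "\<And>X Y. X \<in> A \<Longrightarrow> Y \<in> A \<Longrightarrow> compatible (K1 G) X Y"
    and "\<And>H. nontriv_subgroup G H \<Longrightarrow> \<exists>a\<in>carrier G. H #> a \<in> A"
    and "\<And>H. nontriv_subgroup G H \<Longrightarrow>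
      \<exists>K. nontriv_subgroup G K \<and> (\<exists>a\<in>carrier G. K #> a \<in> A \<and> conj_set G K a = H)"
    and "A \<subseteq> carrier (K1 G)"
  using assms unfolding Sigma_group_K1_iff permissible_def by simp_all

section \<open>Upward closure and the bijection with families\<close>

text \<open>Since larger cosets are lower in the natural order, this is the order ideal generated by
  F when F consists of elements of \<open>K1 G\<close>.\<close>

definition K1_closure :: "'a set set \<Rightarrow> 'a set set" where
  "K1_closure F = {Y \<in> carrier (K1 G). \<exists>X\<in>F. X \<subseteq> Y}"

lemma minimal_cosets_K1: "minimal_cosets \<subseteq> carrier (K1 G)"
  by (auto simp: minimal_cosets_def K1_mem minimal_subgroupsD)

text \<open>Conjugates of minimal subgroups are minimal. So if K^a = H is minimal, then K is minimal
  as well, and the member \<open>Ka\<close> of A survives the intersection.\<close>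

lemma Sigma_group_Int_minimal_cosets:
  assumes "A \<in> carrier (Sigma_group (K1 G))"
  shows "A \<inter> minimal_cosets \<in> A_families G"
proof -
  note A = Sigma_group_K1D(2-4)[OF assms]
  have "\<exists>K\<in>minimal_subgroups G. \<exists>a\<in>carrier G. K #> a \<in> A \<inter> minimal_cosets \<and> conj_set G K a = H"
    if H: "H \<in> minimal_subgroups G" for H
  proof -
    obtain K a where K: "nontriv_subgroup G K" "a \<in> carrier G" "K #> a \<in> A" "conj_set G K a = H"
      using A(3) minimal_subgroupsD[OF H] by blast
    then have "K \<subseteq> carrier G" by (auto dest: nontriv_subgroupD subgroup.subset)
    then have "K = conj_set G H (inv a)"
      using K by (simp add: K(4)[symmetric] conj_set_mult conj_set_one)
    then have "K \<in> minimal_subgroups G" using minimal_subgroups_conj[OF H] K by simp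
    then show ?thesis using K unfolding minimal_cosets_def by blast
  qed
  moreover have "\<exists>a\<in>carrier G. H #> a \<in> A \<inter> minimal_cosets" if "H \<in> minimal_subgroups G" for H
    using A(2)[OF minimal_subgroupsD(1)[OF that]] that unfolding minimal_cosets_def by blast
  ultimately show ?thesis
    unfolding A_families_iff using A(1) by (auto simp: minimal_cosets_def)
qed

lemma K1_closure_cases:
  assumes "Y \<in> K1_closure F" "F \<subseteq> minimal_cosets"
  obtains H K a where "H \<in> minimal_subgroups G" "a \<in> carrier G" "H #> a \<in> F"
    "nontriv_subgroup G K" "H \<subseteq> K" "Y = K #> a"
proof -
  obtain X where X: "X \<in> F" "X \<subseteq> Y" "Y \<in> carrier (K1 G)"
    using assms(1) by (auto simp: K1_closure_def)
  then obtain H a where H: "H \<in> minimal_subgroups G" "a \<in> carrier G" "X = H #> a"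
    using assms(2) by (auto simp: minimal_cosets_def)
  have "natural_le (K1 G) Y (H #> a)"
    using X H K1_natural_le minimal_cosets_K1 assms(2) by blast
  then obtain K where "nontriv_subgroup G K" "H \<subseteq> K" "Y = K #> a"
    using K1_natural_leD X H minimal_subgroupsD(1) by metis
  then show ?thesis using that H X by blast
qed

lemma K1_closure_coset:
  assumes "H #> a \<in> F" "H \<subseteq> K" "nontriv_subgroup G K" "a \<in> carrier G"
  shows "K #> a \<in> K1_closure F"
proof -
  have "H #> a \<subseteq> K #> a" using assms by (auto simp: r_coset_def)
  then show ?thesis using assms K1_mem unfolding K1_closure_def by blast
qed

text \<open>By periodicity every non-trivial subgroup contains a minimal one, so the existence
  conditions pass from F to its closure by enlarging cosets.\<close>

lemma K1_closure_Sigma_group: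
  assumes per: "periodic_group G" and F: "F \<in> A_families G"
  shows "K1_closure F \<in> carrier (Sigma_group (K1 G))"
proof -
  note F' = A_familiesD[OF F]
  have "compatible (K1 G) X Y" if X: "X \<in> K1_closure F" and Y: "Y \<in> K1_closure F" for X Y
  proof -
    obtain H H' a where H: "H \<in> minimal_subgroups G" "a \<in> carrier G" "H #> a \<in> F"
      "nontriv_subgroup G H'" "H \<subseteq> H'" "X = H' #> a"
      using K1_closure_cases[OF X F'(1)] .
    obtain K K' b where K: "K \<in> minimal_subgroups G" "b \<in> carrier G" "K #> b \<in> F"
      "nontriv_subgroup G K'" "K \<subseteq> K'" "Y = K' #> b"
      using K1_closure_cases[OF Y F'(1)] .
    show ?thesis
      using K1_compatible_mono[of H H' a K K' b] H K F'(2) minimal_subgroupsD(1) by blast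
  qed
  moreover have "X \<in> K1_closure F"
    if Y: "Y \<in> K1_closure F" and X: "X \<in> carrier (K1 G)" and le: "natural_le (K1 G) X Y" for X Y
  proof -
    have "Y \<subseteq> X" using le X Y K1_natural_le by (simp add: K1_closure_def)
    then show ?thesis using X Y by (auto simp: K1_closure_def)
  qed
  ultimately have "permissible (K1 G) (K1_closure F)"
    unfolding permissible_def by (auto simp: K1_closure_def)
  moreover have "\<exists>a\<in>carrier G. K #> a \<in> K1_closure F" if K: "nontriv_subgroup G K" for K
  proof -
    obtain H where "H \<in> minimal_subgroups G" "H \<subseteq> K" using periodic_minimal_subgroup[OF per K] .
    then show ?thesis using F'(3) K1_closure_coset K by blast
  qed
  moreover have "\<exists>L. nontriv_subgroup G L \<and> (\<exists>a\<in>carrier G. L #> a \<in> K1_closure F \<and> conj_set G L a = K)"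
    if K: "nontriv_subgroup G K" for K
  proof -
    have KG: "K \<subseteq> carrier G" using K by (auto dest: nontriv_subgroupD subgroup.subset)
    obtain H where "H \<in> minimal_subgroups G" "H \<subseteq> K" using periodic_minimal_subgroup[OF per K] .
    then obtain M a where M: "M \<in> minimal_subgroups G" "a \<in> carrier G" "M #> a \<in> F" "conj_set G M a \<subseteq> K"
      using F'(4) by blast
    \<comment> \<open>This is the subgroup with \<open>?L\<close>^a = K. It contains M because M^a
      lies in K, so \<open>Ma\<close> can be enlarged to \<open>?L #> a\<close>.\<close>
    let ?L = "conj_set G K (inv a)"
    have "conj_set G (conj_set G M a) (inv a) \<subseteq> ?L" using M by (auto simp: conj_set_def)
    then have "M \<subseteq> ?L" using M minimal_subgroupsD[OF M(1)] by (simp add: conj_set_mult conj_set_one)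
    moreover have "nontriv_subgroup G ?L" using K M by (simp add: nontriv_conj)
    moreover have "conj_set G ?L a = K" using KG M by (simp add: conj_set_mult conj_set_one)
    ultimately show ?thesis using M K1_closure_coset by blast
  qed
  ultimately show ?thesis unfolding Sigma_group_K1_iff by blast
qed

lemma bij_betw_Sigma_group_A_families:
  assumes per: "periodic_group G"
  shows "bij_betw (\<lambda>A. A \<inter> minimal_cosets) (carrier (Sigma_group (K1 G))) (A_families G)"
proof (rule bij_betw_byWitness[where f' = K1_closure])
  show "\<forall>A\<in>carrier (Sigma_group (K1 G)). K1_closure (A \<inter> minimal_cosets) = A"
  proof
    fix A assume AS: "A \<in> carrier (Sigma_group (K1 G))"
    note A = Sigma_group_K1D(1,5)[OF AS] and cp = Sigma_group_K1D(2)[OF AS]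
      and dom = Sigma_group_K1D(3)[OF AS]
    show "K1_closure (A \<inter> minimal_cosets) = A"
    proof
      show "K1_closure (A \<inter> minimal_cosets) \<subseteq> A"
      proof
        fix Y assume Y: "Y \<in> K1_closure (A \<inter> minimal_cosets)"
        obtain H K a where H: "H \<in> minimal_subgroups G" "a \<in> carrier G" "H #> a \<in> A \<inter> minimal_cosets"
          "nontriv_subgroup G K" "H \<subseteq> K" "Y = K #> a"
          by (rule K1_closure_cases[OF Y]) auto
        then show "Y \<in> A" using K1_up_mem[OF A(1)] minimal_subgroupsD(1) by blast
      qed
      show "A \<subseteq> K1_closure (A \<inter> minimal_cosets)"
      proof
        fix Y assume Y: "Y \<in> A"
        then obtain K b where K: "nontriv_subgroup G K" "b \<in> carrier G" "Y = K #> b"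
          using A(2) K1_cases by blast
        obtain H where H: "H \<in> minimal_subgroups G" "H \<subseteq> K"
          using periodic_minimal_subgroup[OF per K(1)] .
        obtain a where a: "a \<in> carrier G" "H #> a \<in> A" using dom minimal_subgroupsD[OF H(1)] by blast
        have "K #> a \<in> A" using K1_up_mem[OF A(1) a(2) _ a(1) K(1) H(2)] minimal_subgroupsD[OF H(1)] by blast
        \<comment> \<open>A contains both \<open>K #> b\<close> and \<open>K #> a\<close>, and a
          unit has only one coset of K.\<close>
        then have "Y = K #> a" using K1_compatible_same_subgroup[OF K(1,2) a(1)] cp[OF Y] K(3) by simp
        moreover have "H #> a \<in> A \<inter> minimal_cosets" using a H by (auto simp: minimal_cosets_def)
        then have "K #> a \<in> K1_closure (A \<inter> minimal_cosets)"
          using H(2) K(1) a(1) by (rule K1_closure_coset)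
        ultimately show "Y \<in> K1_closure (A \<inter> minimal_cosets)" by simp
      qed
    qed
  qed
  show "\<forall>F\<in>A_families G. K1_closure F \<inter> minimal_cosets = F"
  proof
    fix F assume F: "F \<in> A_families G"
    then have Fm: "F \<subseteq> minimal_cosets" by (rule A_familiesD(1))
    have "Y \<in> F" if Y: "Y \<in> K1_closure F" "Y \<in> minimal_cosets" for Y
    proof -
      obtain H K a where H: "H \<in> minimal_subgroups G" "a \<in> carrier G" "H #> a \<in> F"
        "nontriv_subgroup G K" "H \<subseteq> K" "Y = K #> a"
        using K1_closure_cases[OF Y(1) Fm] .
      obtain L b where L: "L \<in> minimal_subgroups G" "b \<in> carrier G" "Y = L #> b"
        using Y(2) by (auto simp: minimal_cosets_def)
      \<comment> \<open>A coset determines its subgroup, so K is minimal and the subgroup H of K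
        equals K: the closure adds no new cosets of minimal subgroups.\<close>
      have "K = L"
        using coset_eq_iff[of K L a b] H L nontriv_subgroupD[OF H(4)] minimal_subgroupsD(2)[OF L(1)] by simp
      then have "H = K" using H L by (simp add: minimal_subgroups_def)
      then show ?thesis using H by simp
    qed
    then show "K1_closure F \<inter> minimal_cosets = F"
      using Fm minimal_cosets_K1 by (auto simp: K1_closure_def)
  qed
qed (use Sigma_group_Int_minimal_cosets K1_closure_Sigma_group[OF per] in blast)+


text \<open>
  If \<open>L = K\<^sup>h \<noteq> K\<close>, the modular law gives \<open>H \<subseteq> LK\<close>; but \<open>h\<^sup>-\<^sup>1 \<in> K\<^sup>hK\<close> already forces \<open>h \<in> K\<close>.
\<close>

lemma minimal_subgroups_normalize:
  assumes H: "H \<in> minimal_subgroups G" and K: "K \<in> minimal_subgroups G"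
    and permute: "\<And>H K. H \<in> minimal_subgroups G \<Longrightarrow> K \<in> minimal_subgroups G \<Longrightarrow> H <#> K = K <#> H"
    and h: "h \<in> H"
  shows "conj_set G K h = K"
proof (rule ccontr)
  assume ne: "conj_set G K h \<noteq> K"
  note Hs = minimal_subgroupsD(2,3)[OF H] and Ks = minimal_subgroupsD(2,3)[OF K]
  have hG: "h \<in> carrier G" using h Hs by blast
  define L where "L = conj_set G K h"
  have L: "L \<in> minimal_subgroups G" unfolding L_def using minimal_subgroups_conj K hG .
  note Ls = minimal_subgroupsD(2,3)[OF L]
  have LK: "subgroup (L <#> K) G" using subgroup_set_mult Ls(1) Ks(1) permute[OF L K] .
  have triv: "L \<inter> K = {\<one>}" using minimal_subgroups_Int[OF L K] ne by (simp add: L_def)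
  obtain l where l: "l \<in> L" "l \<noteq> \<one>"
    using minimal_subgroupsD(1)[OF L] subgroup.one_closed[OF Ls(1)]
    unfolding nontriv_subgroup_def by blast
  have HK: "subgroup (H <#> K) G" "generate G (H \<union> K) = H <#> K"
    using subgroup_set_mult generate_Un_permuting Hs(1) Ks(1) permute[OF H K] by simp_all
  have "l \<in> generate G (H \<union> K)"
  proof -
    obtain k where k: "k \<in> K" "l = inv h \<otimes> k \<otimes> h" using l by (auto simp: L_def conj_set_def)
    have "inv h \<in> H" using h Hs by (simp add: subgroup.m_inv_closed)
    then show ?thesis unfolding k(2) using k h by (auto intro!: generate.eng intro: generate.incl)
  qed
  then obtain h1 k1 where hk: "h1 \<in> H" "k1 \<in> K" "l = h1 \<otimes> k1"
    unfolding HK(2) by (auto simp: set_mult_def)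
  have c: "h1 \<in> carrier G" "k1 \<in> carrier G" "inv k1 \<in> K"
    using hk Hs Ks by (auto intro: subgroup.m_inv_closed)
  \<comment> \<open>The factor h1 of l lies in both H and LK. It is not \<one>, as L and K meet
    trivially, so minimality of H places H inside LK.\<close>
  have "h1 = l \<otimes> inv k1" using hk c by (simp add: m_assoc)
  then have "h1 \<in> L <#> K" using l c by (auto simp: set_mult_def)
  moreover have "h1 \<noteq> \<one>"
  proof
    assume "h1 = \<one>"
    then have "l = k1" using hk(3) c by simp
    then have "l \<in> L \<inter> K" using l hk(2) by simp
    then show False unfolding triv using l(2) by simp
  qed
  ultimately have "H \<subseteq> L <#> K" using minimal_subgroup_Int[OF H LK] hk(1) by blast
  moreover have "inv h \<in> H" using h Hs by (simp add: subgroup.m_inv_closed)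
  ultimately have "inv h \<in> L <#> K" ..
  then obtain k k' where k: "k \<in> K" "k' \<in> K" "inv h = inv h \<otimes> k \<otimes> h \<otimes> k'"
    by (auto simp: L_def conj_set_def set_mult_def)
  then have kc: "k \<in> carrier G" "k' \<in> carrier G" using Ks by auto
  \<comment> \<open>The equation for h^-1 reduces to k h k' = \<one>, so h = k^-1 k'^-1 lies in K
    and conjugation by h fixes K, against \<open>ne\<close>.\<close>
  have "h = h \<otimes> inv h \<otimes> h" using hG by simp
  also have "\<dots> = h \<otimes> (inv h \<otimes> k \<otimes> h \<otimes> k') \<otimes> h" using k(3) by simp
  also have "\<dots> = k \<otimes> h \<otimes> k' \<otimes> h" using hG kc by (simp add: m_assoc)
  finally have "\<one> \<otimes> h = (k \<otimes> h \<otimes> k') \<otimes> h" using hG by simp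
  then have "k \<otimes> h \<otimes> k' = \<one>" using hG kc by (metis right_cancel m_closed one_closed)
  then have one: "k \<otimes> (h \<otimes> k') = \<one>" using hG kc by (simp add: m_assoc)
  have "h = inv k \<otimes> (k \<otimes> (h \<otimes> k')) \<otimes> inv k'" using hG kc by (simp add: m_assoc)
  also have "\<dots> = inv k \<otimes> inv k'" using kc by (simp add: one)
  finally have "h \<in> K" using k Ks by (simp add: subgroup.m_closed subgroup.m_inv_closed)
  then show False using conj_set_self[OF Ks(1)] ne by blast
qed

end

section \<open>Counting the families\<close>

text \<open>The distinguished component \<open>j0\<close> realises the exponent: its value is
  normalised to \<one>, which leaves functions on \<open>J - {j0}\<close>.\<close>

locale permuting_minimal_subgroups = group G for G (structure) +
  fixes Hr j0
  assumes permute: "\<And>H K. H \<in> minimal_subgroups G \<Longrightarrow> K \<in> minimal_subgroups G \<Longrightarrow> H <#> K = K <#> H"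
    and Hr: "Hr \<in> minimal_subgroups G"
    and j0: "j0 \<in> conn_components (Gamma_verts G Hr) (Gamma_edges G Hr)"
begin

abbreviation "V \<equiv> Gamma_verts G Hr"
abbreviation "E \<equiv> Gamma_edges G Hr"
abbreviation "J \<equiv> conn_components V E"

definition connected_rel :: "('a set \<times> 'a set) set" where
  "connected_rel = {(u, v). u \<in> V \<and> v \<in> V \<and> (u, v) \<in> E\<^sup>*}"

text \<open>At a vertex this is its connected component; elsewhere, in particular at
  \<open>Hr\<close>, it is empty and hence not in \<open>J\<close>.\<close>

definition component :: "'a set \<Rightarrow> 'a set set" where
  "component H = connected_rel `` {H}"

text \<open>The component \<open>j0\<close> and \<open>Hr\<close>, which lies in no component, both get the value \<open>\<one>\<close>.\<close>

definition shift :: "('a set set \<Rightarrow> 'a) \<Rightarrow> 'a set \<Rightarrow> 'a" where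
  "shift f H = (if component H \<in> J - {j0} then f (component H) else \<one>)"

text \<open>As \<open>shift f\<close> is \<one> at \<open>Hr\<close> and on \<open>j0\<close>, the
  element g is common to the cosets of \<open>Hr\<close> and of all vertices in
  \<open>j0\<close>.\<close>

definition family :: "'a \<Rightarrow> ('a set set \<Rightarrow> 'a) \<Rightarrow> 'a set set" where
  "family g f = (\<lambda>H. H #> (shift f H \<otimes> g)) ` minimal_subgroups G"

section \<open>Components of the graph\<close>

lemma Hr_subgroup: "subgroup Hr G" "Hr \<subseteq> carrier G"
  using minimal_subgroupsD[OF Hr] by simp_all

lemma V_minimal: "H \<in> V \<Longrightarrow> H \<in> minimal_subgroups G" "H \<in> V \<Longrightarrow> H \<noteq> Hr"
  by (auto simp: Gamma_verts_def)

lemma V_I: "H \<in> minimal_subgroups G \<Longrightarrow> H \<noteq> Hr \<Longrightarrow> H \<in> V"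
  by (auto simp: Gamma_verts_def)

lemma V_Int_Hr: "H \<in> V \<Longrightarrow> H \<inter> Hr = {\<one>}"
  using minimal_subgroups_Int[OF _ Hr] V_minimal by blast

lemma equiv_connected_rel: "equiv V connected_rel"
  unfolding connected_rel_def
  by (intro conn_components_partition Gamma_edges_sym Hr_subgroup) (rule group_axioms)

lemma J_eq: "J = V // connected_rel"
  by (simp add: conn_components_def connected_rel_def)

lemma component_mem: "H \<in> V \<Longrightarrow> component H \<in> J"
  unfolding J_eq component_def by (rule quotientI)

lemma component_cases:
  assumes "j \<in> J"
  obtains H where "H \<in> V" "j = component H"
  using assms unfolding J_eq component_def by (rule quotientE)

lemma component_eq: "H \<in> V \<Longrightarrow> K \<in> V \<Longrightarrow> component H = component K \<longleftrightarrow> (H, K) \<in> E\<^sup>*"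
  unfolding component_def using eq_equiv_class_iff[OF equiv_connected_rel, of H K]
  by (auto simp: connected_rel_def)

lemma component_Hr: "component Hr \<notin> J"
proof
  assume "component Hr \<in> J"
  then obtain H where H: "H \<in> V" "component Hr = component H" by (rule component_cases)
  have "component Hr = {}" by (auto simp: component_def connected_rel_def Gamma_verts_def)
  then show False
    using H equiv_class_self[OF equiv_connected_rel] by (auto simp: component_def)
qed

lemma shift_Hr [simp]: "shift f Hr = \<one>"
  using component_Hr by (simp add: shift_def)

lemma shift_mem: "f \<in> Func (J - {j0}) Hr \<Longrightarrow> shift f H \<in> Hr"
  using subgroup.one_closed[OF Hr_subgroup(1)] by (auto simp: shift_def Func_def)

text \<open>Vertices in different components are distinct and not adjacent, so HK meets
  \<open>Hr\<close> non-trivially. As HK is a subgroup, minimality of \<open>Hr\<close> gives the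
  inclusion.\<close>

lemma Hr_subset_set_mult:
  assumes "H \<in> V" "K \<in> V" "component H \<noteq> component K"
  shows "Hr \<subseteq> H <#> K"
proof -
  have "H \<noteq> K" "(H, K) \<notin> E" using assms component_eq[of H K] by auto
  then have "Hr \<inter> (H <#> K) \<noteq> {\<one>}" using assms by (auto simp: Gamma_edges_def)
  moreover have "subgroup (H <#> K) G"
    using assms by (intro subgroup_set_mult permute minimal_subgroupsD V_minimal)
  ultimately show ?thesis using minimal_subgroup_Int[OF Hr] by blast
qed

section \<open>From pairs to families\<close>

lemma compatible_iff:
  assumes "H \<in> minimal_subgroups G" "K \<in> minimal_subgroups G" "a \<in> carrier G" "b \<in> carrier G"
  shows "compatible (K1 G) (H #> a) (K #> b) \<longleftrightarrow> (\<exists>h\<in>H. \<exists>k\<in>K. h \<otimes> a = k \<otimes> b)"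
  using assms by (intro K1_compatible_permuting permute minimal_subgroupsD)

lemma compatible_translate:
  assumes H: "H \<in> minimal_subgroups G" and K: "K \<in> minimal_subgroups G"
    and c: "a \<in> carrier G" "b \<in> carrier G" "g \<in> carrier G"
  shows "compatible (K1 G) (H #> (a \<otimes> g)) (K #> (b \<otimes> g)) \<longleftrightarrow> (\<exists>h\<in>H. \<exists>k\<in>K. h \<otimes> a = k \<otimes> b)"
proof -
  have "h \<otimes> (a \<otimes> g) = k \<otimes> (b \<otimes> g) \<longleftrightarrow> h \<otimes> a = k \<otimes> b" if "h \<in> H" "k \<in> K" for h k
    using that c minimal_subgroupsD(3)[OF H] minimal_subgroupsD(3)[OF K]
    by (simp add: m_assoc[symmetric] subset_iff)
  then show ?thesis using assms by (simp add: compatible_iff)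
qed

text \<open>Equal shifts are themselves a common element, and the coset of \<open>Hr\<close> is
  \<open>Hr\<close> itself, which contains every shift. Different shifts s and t at two vertices
  force different components; then s t^-1 lies in \<open>Hr\<close>, hence in HK, and s t^-1 = h k
  gives h^-1 s = k t.\<close>

lemma shift_compatible:
  assumes f: "f \<in> Func (J - {j0}) Hr" and H: "H \<in> minimal_subgroups G" and K: "K \<in> minimal_subgroups G"
  shows "\<exists>h\<in>H. \<exists>k\<in>K. h \<otimes> shift f H = k \<otimes> shift f K"
proof -
  let ?s = "shift f H" and ?t = "shift f K"
  have st: "?s \<in> Hr" "?t \<in> Hr" using f shift_mem by blast+
  then have c: "?s \<in> carrier G" "?t \<in> carrier G" using Hr_subgroup by auto
  note Hs = minimal_subgroupsD(2,3)[OF H] and Ks = minimal_subgroupsD(2,3)[OF K]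
  note one = subgroup.one_closed[OF Hs(1)] subgroup.one_closed[OF Ks(1)]
  consider "?s = ?t" | "H = Hr" | "K = Hr" | "?s \<noteq> ?t" "H \<in> V" "K \<in> V"
    using H K V_I by blast
  then show ?thesis
  proof cases
    case 1
    then show ?thesis using one by force
  next
    case 2
    then have "?t \<otimes> shift f H = \<one> \<otimes> ?t" using c by simp
    then show ?thesis using 2 st one by blast
  next
    case 3
    then have "\<one> \<otimes> ?s = ?s \<otimes> shift f K" using c by simp
    then show ?thesis using 3 st one by blast
  next
    case 4
    then have "component H \<noteq> component K" by (metis shift_def)
    then have "?s \<otimes> inv ?t \<in> H <#> K"
      using Hr_subset_set_mult 4 st Hr_subgroup
      by (meson subgroup.m_closed subgroup.m_inv_closed subsetD)
    then obtain h k where hk: "h \<in> H" "k \<in> K" "?s \<otimes> inv ?t = h \<otimes> k" by (auto simp: set_mult_def)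
    then have hkc: "h \<in> carrier G" "k \<in> carrier G" using Hs Ks by auto
    have "?s = (?s \<otimes> inv ?t) \<otimes> ?t" using c by (simp add: m_assoc)
    then have "inv h \<otimes> ?s = inv h \<otimes> (h \<otimes> k \<otimes> ?t)" using hk by simp
    also have "\<dots> = k \<otimes> ?t" using hkc c by (simp add: m_assoc)
    finally show ?thesis using hk Hs by (metis subgroup.m_inv_closed)
  qed
qed

lemma family_A_families:
  assumes g: "g \<in> carrier G" and f: "f \<in> Func (J - {j0}) Hr"
  shows "family g f \<in> A_families G"
proof -
  have s: "shift f H \<in> Hr" "shift f H \<in> carrier G" for H
    using shift_mem[OF f] Hr_subgroup(2) by blast+
  have "family g f \<subseteq> minimal_cosets"
    unfolding family_def minimal_cosets_def using s g by blast
  moreover have "\<forall>X\<in>family g f. \<forall>Y\<in>family g f. compatible (K1 G) X Y"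
    using s g shift_compatible[OF f] by (auto simp: family_def compatible_translate)
  moreover have "\<forall>H\<in>minimal_subgroups G. \<exists>a\<in>carrier G. H #> a \<in> family g f"
    using s g by (force simp: family_def)
  moreover have "\<exists>K\<in>minimal_subgroups G. \<exists>a\<in>carrier G. K #> a \<in> family g f \<and> conj_set G K a = H"
    if H: "H \<in> minimal_subgroups G" for H
  proof -
    \<comment> \<open>Chosen so that \<open>?K\<close>^g = H. The shift lies in \<open>Hr\<close>,
      which normalises \<open>?K\<close>, so conjugating by the shift first changes nothing.\<close>
    let ?K = "conj_set G H (inv g)"
    have K: "?K \<in> minimal_subgroups G" using minimal_subgroups_conj[OF H] g by simp
    have "conj_set G ?K (shift f ?K \<otimes> g) = conj_set G (conj_set G ?K (shift f ?K)) g"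
      using conj_set_mult minimal_subgroupsD(3)[OF K] s g by metis
    also have "\<dots> = conj_set G ?K g"
      using minimal_subgroups_normalize[OF Hr K permute s(1)] by simp
    also have "\<dots> = H" using minimal_subgroupsD(3)[OF H] g by (simp add: conj_set_mult conj_set_one)
    finally have "conj_set G ?K (shift f ?K \<otimes> g) = H" .
    moreover have "?K #> (shift f ?K \<otimes> g) \<in> family g f" using K by (simp add: family_def)
    ultimately show ?thesis using K s g by blast
  qed
  ultimately show ?thesis unfolding A_families_iff by blast
qed

text \<open>Equality of the cosets puts t s^-1 in both H and \<open>Hr\<close>, which meet
  trivially.\<close>

lemma coset_shift_unique:
  assumes H: "H \<in> V" and st: "s \<in> Hr" "t \<in> Hr" and g: "g \<in> carrier G"
    and eq: "H #> (s \<otimes> g) = H #> (t \<otimes> g)"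
  shows "s = t"
proof -
  have c: "s \<in> carrier G" "t \<in> carrier G" using st Hr_subgroup by auto
  have Hs: "subgroup H G" using H V_minimal minimal_subgroupsD by blast
  have "(t \<otimes> g) \<otimes> inv (s \<otimes> g) \<in> H" using coset_eq_iff[OF Hs Hs] eq c g by simp
  then have "t \<otimes> inv s \<in> H" using c g by (simp add: inv_mult_group m_assoc)
  moreover have "t \<otimes> inv s \<in> Hr" using st Hr_subgroup by (simp add: subgroup.m_closed subgroup.m_inv_closed)
  ultimately have "t \<otimes> inv s = \<one>" using V_Int_Hr[OF H] by blast
  then show ?thesis using c inv_equality by fastforce
qed

section \<open>Bijectivity\<close>

text \<open>A coset determines its subgroup, so equal families agree at each minimal subgroup. The
  cosets of \<open>Hr\<close> and of one vertex of \<open>j0\<close> together determine g, and then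
  one vertex in each further component determines the value of f there.\<close>

lemma inj_on_family: "inj_on (\<lambda>(g, f). family g f) (carrier G \<times> Func (J - {j0}) Hr)"
proof (rule inj_onI, clarify)
  fix g f g' f'
  assume g: "g \<in> carrier G" "g' \<in> carrier G"
    and f: "f \<in> Func (J - {j0}) Hr" "f' \<in> Func (J - {j0}) Hr" and eq: "family g f = family g' f'"
  have s: "shift f H \<in> carrier G" "shift f' H \<in> carrier G" for H
    using shift_mem f Hr_subgroup(2) by blast+
  have cosets: "H #> (shift f H \<otimes> g) = H #> (shift f' H \<otimes> g')" if H: "H \<in> minimal_subgroups G" for H
  proof -
    have "H #> (shift f H \<otimes> g) \<in> family g' f'"
      unfolding eq[symmetric] using H by (simp add: family_def)
    then obtain K where K: "K \<in> minimal_subgroups G" "H #> (shift f H \<otimes> g) = K #> (shift f' K \<otimes> g')"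
      by (auto simp: family_def)
    have "H = K"
      using coset_eq_iff[OF minimal_subgroupsD(2)[OF H] minimal_subgroupsD(2)[OF K(1)]] K(2) s g by simp
    then show ?thesis using K by simp
  qed
  obtain H0 where H0: "H0 \<in> V" "j0 = component H0" using component_cases[OF j0] .
  have sH0: "shift f H0 = \<one>" "shift f' H0 = \<one>" by (simp_all add: shift_def H0(2)[symmetric])
  have H0s: "H0 \<in> minimal_subgroups G" using H0 V_minimal by blast
  have "g' \<otimes> inv g \<in> H0"
    using cosets[OF H0s] coset_eq_iff[OF minimal_subgroupsD(2)[OF H0s] minimal_subgroupsD(2)[OF H0s]] g
    by (simp add: sH0)
  moreover have "g' \<otimes> inv g \<in> Hr"
    using cosets[OF Hr] coset_eq_iff[OF Hr_subgroup(1) Hr_subgroup(1)] g by simp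
  ultimately have "g' \<otimes> inv g = \<one>" using V_Int_Hr[OF H0(1)] by blast
  then have gg: "g' = g" using g inv_equality by fastforce
  have "f j = f' j" for j
  proof (cases "j \<in> J - {j0}")
    case True
    then obtain H where H: "H \<in> V" "j = component H" using component_cases by blast
    have "shift f H = shift f' H"
      using coset_shift_unique[OF H(1) shift_mem[OF f(1)] shift_mem[OF f(2)] g(1)]
        cosets[OF V_minimal(1)[OF H(1)]] by (simp add: gg)
    then show ?thesis using True H by (simp add: shift_def)
  next
    case False
    \<comment> \<open>Off its domain every member of \<open>Func\<close> takes the value
      \<open>undefined\<close>, so f and f' agree there as well.\<close>
    then show ?thesis using f by (simp add: Func_def)
  qed
  then show "g = g' \<and> f = f'" using gg by auto
qed

lemma family_surj:
  assumes F: "F \<in> A_families G"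
  obtains g f where "g \<in> carrier G" "f \<in> Func (J - {j0}) Hr" "F = family g f"
proof -
  note F' = A_familiesD[OF F]
  obtain H0 where H0: "H0 \<in> V" "j0 = component H0" using component_cases[OF j0] .
  have H0s: "H0 \<in> minimal_subgroups G" using H0 V_minimal by blast
  obtain a b where ab: "a \<in> carrier G" "Hr #> a \<in> F" "b \<in> carrier G" "H0 #> b \<in> F"
    using F'(3) Hr H0s by blast
  then obtain h k where hk: "h \<in> Hr" "k \<in> H0" "h \<otimes> a = k \<otimes> b"
    using compatible_iff[OF Hr H0s] F'(2) by blast
  have rep: "H #> (x \<otimes> c) = H #> c" if "H \<in> minimal_subgroups G" "x \<in> H" "c \<in> carrier G" for H x c
  proof -
    have "x \<in> carrier G" using that minimal_subgroupsD(3) by blast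
    then show ?thesis
      using that minimal_subgroupsD(2,3)[OF that(1)] coset_mult_assoc[of H x c] coset_join2[of x H] by simp
  qed
  \<comment> \<open>The common element of the cosets of \<open>Hr\<close> and \<open>H0\<close>, so
    both can be rewritten with representative g.\<close>
  define g where "g = h \<otimes> a"
  have g: "g \<in> carrier G" unfolding g_def using hk(1) ab(1) Hr_subgroup(2) by blast
  have gF: "Hr #> g \<in> F" "H0 #> g \<in> F"
    using rep[OF Hr hk(1) ab(1)] rep[OF H0s hk(2) ab(3)] ab hk(3) by (simp_all add: g_def)
  \<comment> \<open>The coset of H in F is compatible with \<open>Hr #> g\<close>, so it contains
    some t g with t in \<open>Hr\<close>.\<close>
  have "\<exists>t. t \<in> Hr \<and> H #> (t \<otimes> g) \<in> F" if H: "H \<in> minimal_subgroups G" for H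
  proof -
    obtain c where c: "c \<in> carrier G" "H #> c \<in> F" using F'(3)[OF H] by blast
    then obtain x t where "x \<in> H" "t \<in> Hr" "x \<otimes> c = t \<otimes> g"
      using compatible_iff[OF H Hr c(1) g] F'(2) gF by blast
    then show ?thesis using rep[OF H _ c(1)] c by metis
  qed
  then have "\<forall>H\<in>minimal_subgroups G. \<exists>t. t \<in> Hr \<and> H #> (t \<otimes> g) \<in> F" by blast
  from bchoice[OF this] obtain t where t: "\<And>H. H \<in> minimal_subgroups G \<Longrightarrow> t H \<in> Hr"
    "\<And>H. H \<in> minimal_subgroups G \<Longrightarrow> H #> (t H \<otimes> g) \<in> F" by blast
  have tG: "t H \<in> carrier G" if "H \<in> minimal_subgroups G" for H using t(1)[OF that] Hr_subgroup by blast
  \<comment> \<open>Compatibility puts the quotient of the two shifts in HK, and it also lies in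
    \<open>Hr\<close>; along an edge this intersection is trivial.\<close>
  have edge: "t H = t K" if "(H, K) \<in> E" for H K
  proof -
    have HK: "H \<in> minimal_subgroups G" "K \<in> minimal_subgroups G" "(H <#> K) \<inter> Hr = {\<one>}"
      using that by (auto simp: Gamma_edges_def Gamma_verts_def)
    obtain x y where xy: "x \<in> H" "y \<in> K" "x \<otimes> t H = y \<otimes> t K"
      using compatible_translate[OF HK(1,2) tG[OF HK(1)] tG[OF HK(2)] g] F'(2) t(2)[OF HK(1)] t(2)[OF HK(2)]
      by blast
    have c: "x \<in> carrier G" "y \<in> carrier G" "inv x \<in> H"
      using xy minimal_subgroupsD(2,3)[OF HK(1)] minimal_subgroupsD(3)[OF HK(2)]
      by (auto intro: subgroup.m_inv_closed)
    have "t H = inv x \<otimes> (x \<otimes> t H)" using c tG HK by simp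
    then have "t H \<otimes> inv (t K) = inv x \<otimes> y" unfolding xy(3) using c tG[OF HK(2)] by (simp add: m_assoc)
    then have "t H \<otimes> inv (t K) \<in> H <#> K" using c xy by (auto simp: set_mult_def)
    moreover have "t H \<otimes> inv (t K) \<in> Hr"
      using t(1)[OF HK(1)] t(1)[OF HK(2)] Hr_subgroup by (simp add: subgroup.m_closed subgroup.m_inv_closed)
    ultimately have "t H \<otimes> inv (t K) = \<one>" using HK(3) by blast
    then show ?thesis using tG[OF HK(1)] tG[OF HK(2)] inv_equality by fastforce
  qed
  have path: "t H = t K" if "(H, K) \<in> E\<^sup>*" for H K
    using that by induction (auto dest: edge)
  have comp: "t H = t K" if "H \<in> V" "K \<in> V" "component H = component K" for H K
    using that component_eq path by blast
  \<comment> \<open>F has only one coset of \<open>H0\<close>, so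
    \<open>H0 #> (t H0 \<otimes> g)\<close> coincides with \<open>H0 #> g\<close>.\<close>
  have tH0: "t H0 = \<one>"
  proof -
    have "H0 #> (t H0 \<otimes> g) = H0 #> (\<one> \<otimes> g)"
      using K1_compatible_same_subgroup[OF minimal_subgroupsD(1)[OF H0s] _ g] t(2)[OF H0s] gF(2)
        F'(2) tG[OF H0s] g by simp
    then show ?thesis
      using coset_shift_unique[OF H0(1) t(1)[OF H0s] subgroup.one_closed[OF Hr_subgroup(1)] g] by simp
  qed
  \<comment> \<open>Any vertex may represent its component because t is constant on components. The
    value \<open>undefined\<close> elsewhere is what membership in \<open>Func\<close>
    demands.\<close>
  define f where "f = (\<lambda>j. if j \<in> J - {j0} then t (SOME H. H \<in> V \<and> j = component H) else undefined)"
  have f_eq: "f (component H) = t H" if "H \<in> V" "component H \<noteq> j0" for H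
  proof -
    define K where "K = (SOME K. K \<in> V \<and> component H = component K)"
    have K: "K \<in> V \<and> component H = component K"
      unfolding K_def by (rule someI[of _ H]) (use that in blast)
    have "f (component H) = t K" using that component_mem[OF that(1)] by (simp add: f_def K_def)
    also have "\<dots> = t H" using K comp[OF that(1), of K] by metis
    finally show ?thesis .
  qed
  have f: "f \<in> Func (J - {j0}) Hr"
  proof -
    have "f j \<in> Hr" if j: "j \<in> J" "j \<noteq> j0" for j
    proof -
      obtain H where H: "H \<in> V" "j = component H" using component_cases[OF j(1)] .
      then show ?thesis using f_eq[OF H(1)] j t(1) V_minimal(1) by simp
    qed
    then show ?thesis by (auto simp: Func_def f_def)
  qed
  have shift: "shift f H = t H" if H: "H \<in> V" for H
  proof (cases "component H = j0")
    case True
    have "t H = \<one>" using comp[OF H H0(1)] True H0(2) tH0 by simp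
    then show ?thesis using True by (simp add: shift_def)
  next
    case False
    then show ?thesis using f_eq[OF H] component_mem[OF H] by (simp add: shift_def)
  qed
  have mem: "H #> (shift f H \<otimes> g) \<in> F" if H: "H \<in> minimal_subgroups G" for H
    using gF(1) g t(2)[OF H] shift[OF V_I[OF H]] by (cases "H = Hr") auto
  have "F = family g f"
  proof
    show "family g f \<subseteq> F" using mem by (auto simp: family_def)
    show "F \<subseteq> family g f"
    proof
      \<comment> \<open>X is a coset of some minimal H, and F also contains the coset of H from
        \<open>family g f\<close>; compatibility makes the two equal.\<close>
      fix X assume X: "X \<in> F"
      then obtain H c where H: "H \<in> minimal_subgroups G" "c \<in> carrier G" "X = H #> c"
        using F'(1) by (auto simp: minimal_cosets_def)
      have "shift f H \<otimes> g \<in> carrier G" using shift_mem[OF f] Hr_subgroup(2) g by blast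
      then have "X = H #> (shift f H \<otimes> g)"
        using K1_compatible_same_subgroup[OF minimal_subgroupsD(1)[OF H(1)] H(2)] F'(2)[OF X mem[OF H(1)]] H(3)
        by simp
      then show "X \<in> family g f" using H(1) by (simp add: family_def)
    qed
  qed
  then show ?thesis using that g f by blast
qed

lemma bij_betw_family:
  "bij_betw (\<lambda>(g, f). family g f) (carrier G \<times> Func (J - {j0}) Hr) (A_families G)"
proof (rule bij_betw_imageI[OF inj_on_family], rule subset_antisym)
  show "(\<lambda>(g, f). family g f) ` (carrier G \<times> Func (J - {j0}) Hr) \<subseteq> A_families G"
    using family_A_families by auto
  show "A_families G \<subseteq> (\<lambda>(g, f). family g f) ` (carrier G \<times> Func (J - {j0}) Hr)"
  proof
    fix F assume "F \<in> A_families G"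
    then obtain g f where "g \<in> carrier G" "f \<in> Func (J - {j0}) Hr" "F = family g f"
      by (rule family_surj)
    then show "F \<in> (\<lambda>(g, f). family g f) ` (carrier G \<times> Func (J - {j0}) Hr)" by force
  qed
qed

end

theorem theorem3p7:
  fixes G :: "('a, 'b) monoid_scheme" and Hr :: "'a set"
  assumes "group G"
    and "carrier G \<noteq> {\<one>\<^bsub>G\<^esub>}"
    and "periodic_group G"
    and "\<And>H K. H \<in> minimal_subgroups G \<Longrightarrow> K \<in> minimal_subgroups G \<Longrightarrow>
           H <#>\<^bsub>G\<^esub> K = K <#>\<^bsub>G\<^esub> H"
    and "\<exists>H\<in>minimal_subgroups G. \<exists>K\<in>minimal_subgroups G. H \<noteq> K"
    and "Hr \<in> minimal_subgroups G"
  shows "|carrier (Sigma_group (K1 G))| =o |A_families G| \<and>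
         |A_families G| =o |carrier G| *c
           ( |Hr| ^c card_minus_one (conn_components (Gamma_verts G Hr) (Gamma_edges G Hr)))"
proof
  interpret group G by fact
  show "|carrier (Sigma_group (K1 G))| =o |A_families G|"
    using bij_betw_Sigma_group_A_families[OF assms(3)] by (rule card_of_ordIsoI)
  let ?J = "conn_components (Gamma_verts G Hr) (Gamma_edges G Hr)"
  \<comment> \<open>The same choice as in \<open>card_minus_one\<close>, so the exponent unfolds to
    exactly the cardinal of \<open>?J - {j0}\<close>. It lies in \<open>?J\<close> because a second
    minimal subgroup supplies a vertex.\<close>
  define j0 where "j0 = (SOME j. j \<in> ?J)"
  obtain H where "H \<in> Gamma_verts G Hr" using assms(5) by (auto simp: Gamma_verts_def)
  then have "?J \<noteq> {}" unfolding conn_components_def by (auto simp: quotient_def)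
  then have "j0 \<in> ?J" unfolding j0_def by (simp add: some_in_eq)
  then interpret permuting_minimal_subgroups G Hr j0
    by unfold_locales (use assms(4,6) in auto)
  have "|A_families G| =o |carrier G \<times> Func (?J - {j0}) Hr|"
    using bij_betw_family by (rule card_of_ordIsoI[THEN ordIso_symmetric])
  then show "|A_families G| =o |carrier G| *c ( |Hr| ^c card_minus_one ?J)"
    by (simp add: cprod_def cexp_def card_minus_one_def j0_def[symmetric] Field_card_of)
qed

end
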